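(* Let $k$ be a field of characteristic zero, let $A$ be the Grossman-Larson Hopf algebra of rooted trees over $k$, with unit $e$ (the one-vertex tree), counit $\varepsilon$, comultiplication $\Delta$ and antipode $S$, and let $N:A\to A$ be the natural growth operator. For each integer $j\geq 0$ put $x_j=N^j(e)\in A$. Then for all integers $m,n\geq 0$: (1) $x_mx_n=x_nx_m=x_{m+n}$; (2) $x_0=e$; (3) $\varepsilon(x_m)=\delta_{0,m}$ (Kronecker delta); (4) $\Delta(x_m)=\sum_{i=0}^m\binom{m}{i}x_i\otimes x_{m-i}$; (5) $S(x_m)=(-1)^mx_m$. Moreover, the elements $\{x_j\}_{j\geq 0}$ are linearly independent. Hence, the subspace of $A$ generated by the elements $x_j$ with $j\geq 0$ is a commutative cocommutative Hopf subalgebra of $A$, isomorphic (as a Hopf algebra) to the polynomial algebra $k[X]$ with its usual Hopf algebra structure.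
   Context: All algebras, linear spaces and tensor products are over $k$. The usual Hopf algebra structure on $k[X]$ is the one in which $X$ is primitive: $\Delta(X)=X\otimes 1+1\otimes X$, $\varepsilon(X)=0$, $S(X)=-X$. A rooted tree is a finite, connected and simply-connected set of oriented edges and vertices with exactly one distinguished vertex with no incoming edges, the root; edges are oriented away from the root, and trees are considered up to isomorphism (no ordering of children, no labels). The children of a vertex $v$ are the endpoints of the edges outgoing from $v$. All trees are non-empty; $e$ denotes the rooted tree with only one vertex. The Hopf algebra $A$: as a vector space it has a basis consisting of all rooted trees. The unit is $e$. Product: for rooted trees $t_1,t_2$, let $s_1,\dots,s_r$ be the children of the root of $t_1$ and $n$ the number of vertices of $t_2$; there are $n^r$ ways to attach the $r$ subtrees of $t_1$ with roots $s_1,\dots,s_r$ to $t_2$ by making each $s_i$ a child of some vertex of $t_2$ (the root of the result being the root of $t_2$); $t_1t_2$ is the sum of these $n^r$ rooted trees (with multiplicity). Coproduct: if $t$ is a rooted tree whose root has children $s_1,\dots,s_r$, then $\Delta(t)$ is the sum of the $2^r$ terms $t_1\otimes t_2$, where the children of the root of $t_1$ and the children of the root of $t_2$ (together with the subtrees they carry) range over all $2^r$ ordered partitions of $\{s_1,\dots,s_r\}$ into two (possibly empty) subsets; $\Delta(e)=e\otimes e$. Counit: $\varepsilon(e)=1$, $\varepsilon(t)=0$ for $t\neq e$. It is known that $A$ is a graded connected cocommutative Hopf algebra (so it has an antipode), the degree $n$ component $A_n$ having as basis the trees with $n+1$ vertices. Natural growth operator: $N:A\to A$ is the linear map such that, for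 any rooted tree $t$ with $n$ vertices, $N(t)$ is the sum (with multiplicity) of the $n$ rooted trees obtained from $t$ by attaching one more outgoing edge and vertex to each vertex of $t$ in turn (the root remaining the same). In particular $N(e)$ is the rooted tree with two vertices. $N^j$ denotes the $j$-fold composition, $N^0=\mathrm{id}$. *)

theory Defs
  imports
    Complex_Main
    "HOL-Library.Multiset"
    "HOL-Library.FuncSet"
    "HOL-Library.Poly_Mapping"
    "HOL-Computational_Algebra.Polynomial"
begin

section \<open>Rooted trees\<close>

text \<open>
  Since the children of a vertex form a multiset, two values of this type are equal iff the
  trees are isomorphic as unlabelled, unordered rooted trees.
\<close>

datatype rtree = Node "rtree multiset"

definition e_tree :: rtree where
  "e_tree = Node {#}"

text \<open>
  An isomorphism class of trees has no vertices that one could point at. All constructions are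
  therefore carried out on a representative whose vertices are pairwise distinct labels; by
  distinctness the children of its root form a set of labelled subtrees.
\<close>

datatype 'v ltree = LNode 'v "'v ltree multiset"

primrec shape :: "'v ltree \<Rightarrow> rtree" where
  "shape (LNode v G) = Node (image_mset shape G)"

primrec labels :: "'v ltree \<Rightarrow> 'v multiset" where
  "labels (LNode v G) = add_mset v (\<Sum>\<^sub># (image_mset labels G))"

primrec lchildren :: "'v ltree \<Rightarrow> 'v ltree set" where
  "lchildren (LNode v G) = set_mset G"

definition vertices :: "'v ltree \<Rightarrow> 'v set" where
  "vertices L = set_mset (labels L)"

definition distinct_labels :: "'v ltree \<Rightarrow> bool" where
  "distinct_labels L \<longleftrightarrow> (\<forall>v. count (labels L) v \<le> 1)"

definition rep :: "rtree \<Rightarrow> nat ltree" where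
  "rep t = (SOME L. shape L = t \<and> distinct_labels L)"

definition shapes :: "'v ltree set \<Rightarrow> rtree multiset" where
  "shapes P = image_mset shape (mset_set P)"

text \<open>
  \<open>graft L f\<close> is the tree obtained from \<open>L\<close> by making the roots of the trees in \<open>f v\<close>
  additional children of the vertex \<open>v\<close>, for all vertices \<open>v\<close> of \<open>L\<close> at once.
\<close>

primrec graft :: "'v ltree \<Rightarrow> ('v \<Rightarrow> rtree multiset) \<Rightarrow> rtree" where
  "graft (LNode v G) f = Node (image_mset (\<lambda>L. graft L f) G + f v)"

lemma count_image_mset_of_inj: "inj f \<Longrightarrow> count (image_mset f M) (f x) = count M x"
  by (induction M) (auto simp: inj_eq)

lemma labels_map_ltree: "labels (map_ltree f L) = image_mset f (labels L)"
proof (induction L)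
  case (LNode v G)
  have "image_mset (\<lambda>L. labels (map_ltree f L)) G = image_mset (\<lambda>L. image_mset f (labels L)) G"
    using LNode by (intro image_mset_cong) auto
  moreover have "\<Sum>\<^sub># (image_mset (\<lambda>L. image_mset f (labels L)) G)
      = image_mset f (\<Sum>\<^sub># (image_mset labels G))"
    by (induction G) auto
  ultimately show ?case by (simp add: multiset.map_comp comp_def)
qed

lemma shape_map_ltree: "shape (map_ltree f L) = shape L"
proof (induction L)
  case (LNode v G)
  then show ?case by (simp add: multiset.map_comp comp_def cong: image_mset_cong)
qed

lemma ex_distinct_labels: "\<exists>L :: nat ltree. shape L = t \<and> distinct_labels L"
proof (induction t)
  case (Node F)
  have "\<exists>G :: nat ltree multiset. image_mset shape G = F \<and>
      (\<forall>v. count (\<Sum>\<^sub># (image_mset labels G)) v \<le> 1)"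
    using Node
  proof (induction F)
    case empty
    then show ?case by auto
  next
    case (add s F)
    obtain L :: "nat ltree" where L: "shape L = s" "\<And>v. count (labels L) v \<le> 1"
      using add.prems unfolding distinct_labels_def by (metis union_single_eq_member)
    obtain G :: "nat ltree multiset" where G: "image_mset shape G = F"
      "\<And>v. count (\<Sum>\<^sub># (image_mset labels G)) v \<le> 1"
      using add by (metis insert_iff set_mset_add_mset_insert)
    let ?ev = "\<lambda>n::nat. 2 * n" and ?od = "\<lambda>n::nat. 2 * n + 1"
    let ?G = "add_mset (map_ltree ?ev L) (image_mset (map_ltree ?od) G)"
    have lab: "\<Sum>\<^sub># (image_mset labels ?G)
        = image_mset ?ev (labels L) + image_mset ?od (\<Sum>\<^sub># (image_mset labels G))"
    proof -
      have "\<Sum>\<^sub># (image_mset (\<lambda>L. image_mset ?od (labels L)) G)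
          = image_mset ?od (\<Sum>\<^sub># (image_mset labels G))"
        by (induction G) auto
      then show ?thesis by (simp add: labels_map_ltree multiset.map_comp comp_def)
    qed
    have cnt: "count (image_mset ?ev M + image_mset ?od K) v \<le> 1"
      if "\<And>v. count M v \<le> 1" "\<And>v. count K v \<le> 1" for M K :: "nat multiset" and v
    proof (cases "even v")
      case True
      then obtain n where n: "v = 2 * n" by blast
      have "count (image_mset ?ev M) (?ev n) = count M n"
        by (rule count_image_mset_of_inj) (auto intro: injI)
      moreover have "v \<notin># image_mset ?od K" using n by auto presburger
      then have "count (image_mset ?od K) v = 0" by (simp only: not_in_iff)
      ultimately show ?thesis using that(1)[of n] n by simp
    next
      case False
      then obtain n where n: "v = 2 * n + 1" by (blast elim: oddE)
      have "count (image_mset ?od K) (?od n) = count K n"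
        by (rule count_image_mset_of_inj) (auto intro: injI)
      moreover have "v \<notin># image_mset ?ev M" using n by auto presburger
      then have "count (image_mset ?ev M) v = 0" by (simp only: not_in_iff)
      ultimately show ?thesis using that(2)[of n] n by simp
    qed
    have "image_mset shape ?G = add_mset s F"
      using L(1) G(1) by (simp add: shape_map_ltree multiset.map_comp comp_def)
    moreover have "\<forall>v. count (\<Sum>\<^sub># (image_mset labels ?G)) v \<le> 1"
      unfolding lab using cnt L(2) G(2) by blast
    ultimately show ?case by blast
  qed
  then obtain G :: "nat ltree multiset" where G: "image_mset shape G = F"
    "\<And>v. count (\<Sum>\<^sub># (image_mset labels G)) v \<le> 1" by blast
  define L where "L = LNode 0 (image_mset (map_ltree Suc) G)"
  have eq: "\<Sum>\<^sub># (image_mset (\<lambda>L. image_mset Suc (labels L)) G)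
      = image_mset Suc (\<Sum>\<^sub># (image_mset labels G))"
    by (induction G) auto
  have "labels L = add_mset 0 (image_mset Suc (\<Sum>\<^sub># (image_mset labels G)))"
    unfolding L_def using eq by (simp add: labels_map_ltree multiset.map_comp comp_def)
  moreover have "count (add_mset 0 (image_mset Suc M)) v \<le> 1"
    if "\<And>v. count M v \<le> 1" for M :: "nat multiset" and v
  proof (cases v)
    case 0
    have "0 \<notin># image_mset Suc M" by auto
    then have "count (image_mset Suc M) 0 = 0" by (simp only: not_in_iff)
    then show ?thesis using 0 by simp
  next
    case (Suc n)
    have "count (image_mset Suc M) (Suc n) = count M n"
      by (rule count_image_mset_of_inj) auto
    then show ?thesis using Suc that by simp
  qed
  ultimately have "distinct_labels L" unfolding distinct_labels_def using G(2) by simp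
  moreover have "shape L = Node F"
    unfolding L_def using G(1) by (simp add: shape_map_ltree multiset.map_comp comp_def)
  ultimately show ?case by blast
qed

lemma shape_rep: "shape (rep t) = t" and distinct_labels_rep: "distinct_labels (rep t)"
  unfolding rep_def using someI_ex[OF ex_distinct_labels[of t]] by blast+


section \<open>Vector spaces with a given basis\<close>

text \<open>
  \<open>'b \<Rightarrow>\<^sub>0 'k\<close> is the space with basis \<open>'b\<close>, the basis vector of \<open>b\<close> being
  \<open>Poly_Mapping.single b 1\<close>. The tensor product of the spaces with bases \<open>'b\<close> and \<open>'c\<close> is
  the space with basis \<open>'b \<times> 'c\<close>.
\<close>

definition scale :: "'k::field \<Rightarrow> ('b \<Rightarrow>\<^sub>0 'k) \<Rightarrow> ('b \<Rightarrow>\<^sub>0 'k)" where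
  "scale c v = Poly_Mapping.map ((*) c) v"

lemma lookup_scale [simp]: "Poly_Mapping.lookup (scale c v) b = c * Poly_Mapping.lookup v b"
  by (simp add: scale_def map.rep_eq when_def)

global_interpretation fvs: vector_space "scale :: 'k::field \<Rightarrow> ('b \<Rightarrow>\<^sub>0 'k) \<Rightarrow> ('b \<Rightarrow>\<^sub>0 'k)"
  by unfold_locales (auto intro!: poly_mapping_eqI simp: lookup_add algebra_simps)

definition lin_ext :: "('b \<Rightarrow> ('c \<Rightarrow>\<^sub>0 'k)) \<Rightarrow> ('b \<Rightarrow>\<^sub>0 'k::field) \<Rightarrow> ('c \<Rightarrow>\<^sub>0 'k)" where
  "lin_ext f v = (\<Sum>b\<in>Poly_Mapping.keys v. scale (Poly_Mapping.lookup v b) (f b))"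

definition tens :: "('b \<Rightarrow>\<^sub>0 'k::field) \<Rightarrow> ('c \<Rightarrow>\<^sub>0 'k) \<Rightarrow> ('b \<times> 'c \<Rightarrow>\<^sub>0 'k)"  (infixr "\<otimes>\<^sub>k" 75) where
  "v \<otimes>\<^sub>k w = (\<Sum>b\<in>Poly_Mapping.keys v. \<Sum>c\<in>Poly_Mapping.keys w.
     Poly_Mapping.single (b, c) (Poly_Mapping.lookup v b * Poly_Mapping.lookup w c))"

definition tensor_map ::
    "(('b \<Rightarrow>\<^sub>0 'k::field) \<Rightarrow> ('d \<Rightarrow>\<^sub>0 'k)) \<Rightarrow> (('c \<Rightarrow>\<^sub>0 'k) \<Rightarrow> ('f \<Rightarrow>\<^sub>0 'k)) \<Rightarrow>
     ('b \<times> 'c \<Rightarrow>\<^sub>0 'k) \<Rightarrow> ('d \<times> 'f \<Rightarrow>\<^sub>0 'k)" where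
  "tensor_map f g = lin_ext (\<lambda>(b, c).
     f (Poly_Mapping.single b 1) \<otimes>\<^sub>k g (Poly_Mapping.single c 1))"

definition tensor_flip :: "('b \<times> 'c \<Rightarrow>\<^sub>0 'k::field) \<Rightarrow> ('c \<times> 'b \<Rightarrow>\<^sub>0 'k)" where
  "tensor_flip = lin_ext (\<lambda>(b, c). Poly_Mapping.single (c, b) 1)"


section \<open>The Grossman-Larson Hopf algebra of rooted trees\<close>

type_synonym 'k GL = "rtree \<Rightarrow>\<^sub>0 'k"

definition GL_unit :: "'k::field GL" where
  "GL_unit = Poly_Mapping.single e_tree 1"

text \<open>
  The function \<open>g\<close> ranges over the \<open>n ^ r\<close> ways of assigning to each of the \<open>r\<close> children of the
  root of \<open>t1\<close> one of the \<open>n\<close> vertices of \<open>t2\<close>.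
\<close>

definition tree_mult :: "rtree \<Rightarrow> rtree \<Rightarrow> 'k::field GL" where
  "tree_mult t1 t2 = (\<Sum>g \<in> lchildren (rep t1) \<rightarrow>\<^sub>E vertices (rep t2).
     Poly_Mapping.single
       (graft (rep t2) (\<lambda>v. shapes {s \<in> lchildren (rep t1). g s = v})) 1)"

text \<open>Multiplication as a linear map on the tensor square.\<close>

definition GL_mult_lin :: "(rtree \<times> rtree \<Rightarrow>\<^sub>0 'k::field) \<Rightarrow> 'k GL" where
  "GL_mult_lin = lin_ext (\<lambda>(t1, t2). tree_mult t1 t2)"

definition GL_mult :: "'k::field GL \<Rightarrow> 'k GL \<Rightarrow> 'k GL"  (infixl "\<star>" 70) where
  "a \<star> b = GL_mult_lin (a \<otimes>\<^sub>k b)"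

definition tree_comult :: "rtree \<Rightarrow> (rtree \<times> rtree \<Rightarrow>\<^sub>0 'k::field)" where
  "tree_comult t = (\<Sum>P \<in> Pow (lchildren (rep t)).
     Poly_Mapping.single (Node (shapes P), Node (shapes (lchildren (rep t) - P))) 1)"

definition GL_comult :: "'k::field GL \<Rightarrow> (rtree \<times> rtree \<Rightarrow>\<^sub>0 'k)" where
  "GL_comult = lin_ext tree_comult"

definition GL_counit :: "'k::field GL \<Rightarrow> 'k" where
  "GL_counit a = Poly_Mapping.lookup a e_tree"

definition is_GL_antipode :: "('k::field GL \<Rightarrow> 'k GL) \<Rightarrow> bool" where
  "is_GL_antipode S \<longleftrightarrow> Vector_Spaces.linear scale scale S \<and>
     (\<forall>a. GL_mult_lin (tensor_map S id (GL_comult a)) = scale (GL_counit a) GL_unit \<and>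
          GL_mult_lin (tensor_map id S (GL_comult a)) = scale (GL_counit a) GL_unit)"

definition GL_antipode :: "'k::field GL \<Rightarrow> 'k GL" where
  "GL_antipode = (THE S. is_GL_antipode S)"

definition tree_growth :: "rtree \<Rightarrow> 'k::field GL" where
  "tree_growth t = (\<Sum>v \<in> vertices (rep t).
     Poly_Mapping.single (graft (rep t) (\<lambda>w. if w = v then {#e_tree#} else {#})) 1)"

definition natural_growth :: "'k::field GL \<Rightarrow> 'k GL" where
  "natural_growth = lin_ext tree_growth"

text \<open>The space \<open>H \<otimes> H\<close> is identified with its image in the tensor square of the whole algebra.\<close>

definition GL_hopf_subalgebra :: "'k::field GL set \<Rightarrow> bool" where
  "GL_hopf_subalgebra H \<longleftrightarrow>
     fvs.subspace H \<and> GL_unit \<in> H \<and>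
     (\<forall>a\<in>H. \<forall>b\<in>H. a \<star> b \<in> H) \<and>
     (\<forall>a\<in>H. GL_comult a \<in> fvs.span {b \<otimes>\<^sub>k c | b c. b \<in> H \<and> c \<in> H}) \<and>
     (\<forall>a\<in>H. GL_antipode a \<in> H)"

definition GL_commutative_on :: "'k::field GL set \<Rightarrow> bool" where
  "GL_commutative_on H \<longleftrightarrow> (\<forall>a\<in>H. \<forall>b\<in>H. a \<star> b = b \<star> a)"

definition GL_cocommutative_on :: "'k::field GL set \<Rightarrow> bool" where
  "GL_cocommutative_on H \<longleftrightarrow> (\<forall>a\<in>H. tensor_flip (GL_comult a) = GL_comult a)"


section \<open>The Hopf algebra of polynomials\<close>

text \<open>
  The algebra \<open>k[X] \<otimes> k[X]\<close> is \<open>k[X][Y]\<close>, i.e. \<open>'k poly poly\<close>, with \<open>p \<otimes> q = p(X) q(Y)\<close>.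
  The comultiplication and the antipode are the algebra homomorphisms with
  \<open>X \<mapsto> X \<otimes> 1 + 1 \<otimes> X\<close> and \<open>X \<mapsto> - X\<close>.
\<close>

definition poly_tens :: "'k::field poly \<Rightarrow> 'k poly \<Rightarrow> 'k poly poly" where
  "poly_tens p q = smult p (map_poly (\<lambda>c. [:c:]) q)"

definition poly_comult :: "'k::field poly \<Rightarrow> 'k poly poly" where
  "poly_comult p = poly (map_poly (\<lambda>c. [:[:c:]:]) p)
     (poly_tens [:0, 1:] 1 + poly_tens 1 [:0, 1:])"

definition poly_counit :: "'k::field poly \<Rightarrow> 'k" where
  "poly_counit p = poly p 0"

definition poly_antipode :: "'k::field poly \<Rightarrow> 'k poly" where
  "poly_antipode p = pcompose p [:0, -1:]"

text \<open>The map \<open>\<phi> \<otimes> \<phi>\<close>, given by its values on the basis \<open>X\<^sup>i \<otimes> X\<^sup>j\<close> of \<open>k[X] \<otimes> k[X]\<close>.\<close>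

definition poly_tensor_map ::
    "('k::field poly \<Rightarrow> ('b \<Rightarrow>\<^sub>0 'k)) \<Rightarrow> 'k poly poly \<Rightarrow> ('b \<times> 'b \<Rightarrow>\<^sub>0 'k)" where
  "poly_tensor_map \<phi> P = (\<Sum>j\<le>degree P. \<Sum>i\<le>degree (coeff P j).
     scale (coeff (coeff P j) i) (\<phi> (monom 1 i) \<otimes>\<^sub>k \<phi> (monom 1 j)))"

definition poly_GL_hopf_iso :: "('k::field poly \<Rightarrow> 'k GL) \<Rightarrow> 'k GL set \<Rightarrow> bool" where
  "poly_GL_hopf_iso \<phi> H \<longleftrightarrow>
     Vector_Spaces.linear smult scale \<phi> \<and> bij_betw \<phi> UNIV H \<and>
     \<phi> 1 = GL_unit \<and> (\<forall>p q. \<phi> (p * q) = \<phi> p \<star> \<phi> q) \<and>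
     (\<forall>p. GL_comult (\<phi> p) = poly_tensor_map \<phi> (poly_comult p)) \<and>
     (\<forall>p. GL_counit (\<phi> p) = poly_counit p) \<and>
     (\<forall>p. GL_antipode (\<phi> p) = \<phi> (poly_antipode p))"

end

theory Submission
  imports Defs
begin

text \<open>
  Multiplying by the primitive element \<open>p = Node {#e_tree#}\<close> is natural growth, so \<open>x\<^sub>j\<close> is the
  \<open>j\<close>-th power of \<open>p\<close> once the product is known to be associative. Associativity rests on the
  Guin-Oudom recursion: grafting \<open>s\<close> onto a grafting of the forest \<open>F\<close> on \<open>t\<close> amounts to grafting
  \<open>F\<close> and \<open>s\<close> on \<open>t\<close>, or to grafting on \<open>t\<close> the forest obtained from \<open>F\<close> by letting \<open>s\<close> grow on
  one of its trees. The antipode is the convolution inverse of the identity, a geometric series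
  that is finite on each tree. The elements \<open>x\<^sub>j\<close> are independent because the coefficient
  of the corolla with \<open>n\<close> leaves in \<open>x\<^sub>j\<close> is 1 if \<open>j = n\<close> and 0 otherwise.
\<close>

section \<open>Grafting and splitting forests\<close>

text \<open>The definitions work on labelled representatives picked by \<open>rep\<close>, and
  nothing relates the representative of a tree to those of its subtrees, so no recursion can run on
  them directly. Growth, attachment and splitting are therefore recast with multisets as formal sums
  with multiplicity. Labels remain only on the tree that is grafted onto, and
  \<open>sum_attach_PiE\<close> and \<open>sum_splits_Pow\<close> are the bridges from function
  spaces and power sets. Identities between such formal sums are stated as sums of an arbitrary
  function \<open>h\<close> into a commutative monoid: an induction can absorb a further tree into
  \<open>h\<close>, and the choice \<open>basis_vec\<close> turns the identity into one in the
  algebra. The antipode is given by \<open>THE\<close>, so its existence and its uniqueness have to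
  be proved before its axioms can be used; both rest on associativity.\<close>

lemma image_mset_sum_mset:
  "image_mset f (\<Sum>x\<in>#M. g x) = (\<Sum>x\<in>#M. image_mset f (g x))"
  by (induction M) auto

lemma image_mset_sum: "image_mset f (\<Sum>x\<in>V. g x) = (\<Sum>x\<in>V. image_mset f (g x))"
  by (induction V rule: infinite_finite_induct) auto

lemma sum_mset_bind:
  "(\<Sum>y\<in>#(\<Sum>x\<in>V. f x). h y) = (\<Sum>x\<in>V. \<Sum>y\<in>#f x. (h y :: 'a::comm_monoid_add))"
  by (induction V rule: infinite_finite_induct) auto

lemma sum_mset_sum_swap:
  "(\<Sum>x\<in>#M. \<Sum>v\<in>V. h x v) = (\<Sum>v\<in>V. \<Sum>x\<in>#M. (h x v :: 'a::comm_monoid_add))"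
  by (induction M) (auto simp: sum.distrib)

text \<open>The extension of \<open>g\<close> to a derivation of the symmetric algebra: multisets
  are monomials, multisets of multisets are formal sums of monomials, and the sum over
  \<open>u\<close> is the Leibniz rule.\<close>

definition deriv_mset :: "('a \<Rightarrow> 'a multiset) \<Rightarrow> 'a multiset \<Rightarrow> 'a multiset multiset" where
  "deriv_mset g F = (\<Sum>u\<in>#F. image_mset (\<lambda>w. add_mset w (F - {#u#})) (g u))"

lemma deriv_mset_empty [simp]: "deriv_mset g {#} = {#}"
  by (simp add: deriv_mset_def)

lemma deriv_mset_add_mset:
  "deriv_mset g (add_mset u F) =
     image_mset (add_mset u) (deriv_mset g F) + image_mset (\<lambda>w. add_mset w F) (g u)"
proof -
  have "(\<Sum>x\<in>#F. image_mset (\<lambda>w. add_mset w (add_mset u F - {#x#})) (g x))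
      = (\<Sum>x\<in>#F. image_mset (add_mset u) (image_mset (\<lambda>w. add_mset w (F - {#x#})) (g x)))"
    by (intro arg_cong[where f = sum_mset] image_mset_cong)
      (auto simp: multiset.map_comp comp_def add_mset_commute intro!: image_mset_cong)
  then show ?thesis
    by (simp add: deriv_mset_def image_mset_sum_mset)
qed

lemma sum_deriv_mset_add_mset:
  "(\<Sum>G\<in>#deriv_mset g (add_mset u F). h G) =
     (\<Sum>G\<in>#deriv_mset g F. h (add_mset u G)) + (\<Sum>w\<in>#g u. (h (add_mset w F) :: 'a::comm_monoid_add))"
  by (simp add: deriv_mset_add_mset multiset.map_comp comp_def)

lemma sum_deriv_mset_union:
  "(\<Sum>G\<in>#deriv_mset g (F + F'). h G) =
     (\<Sum>G\<in>#deriv_mset g F. h (G + F')) + (\<Sum>G\<in>#deriv_mset g F'. (h (F + G) :: 'a::comm_monoid_add))"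
  by (induction F arbitrary: h) (auto simp: sum_deriv_mset_add_mset add_ac)

lemma size_deriv_mset: "G \<in># deriv_mset g F \<Longrightarrow> size G = size F"
  by (induction F arbitrary: G) (auto simp: deriv_mset_add_mset)

text \<open>The result lists the tree with \<open>s\<close> hung below each vertex in turn. Pairing
  \<open>u\<close> with \<open>growths s u\<close> lets a primitive recursion through
  \<open>image_mset\<close> still remove the original child \<open>u\<close> from
  \<open>F\<close>.\<close>

primrec growths :: "rtree \<Rightarrow> rtree \<Rightarrow> rtree multiset" where
  "growths s (Node F) = add_mset (Node (add_mset s F)) (image_mset Node
     (\<Sum>(u, U)\<in>#image_mset (\<lambda>u. (u, growths s u)) F. image_mset (\<lambda>w. add_mset w (F - {#u#})) U))"

lemma growths_Node: "growths s (Node F) =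
    add_mset (Node (add_mset s F)) (image_mset Node (deriv_mset (growths s) F))"
  by (simp add: deriv_mset_def multiset.map_comp comp_def)

declare growths.simps [simp del]

lemma sum_growths_Node:
  "(\<Sum>w\<in>#growths s (Node F). h w) =
     h (Node (add_mset s F)) + (\<Sum>G\<in>#deriv_mset (growths s) F. (h (Node G) :: 'a::comm_monoid_add))"
  by (simp add: growths_Node multiset.map_comp comp_def)

section \<open>Growth of a grafted tree, vertex by vertex\<close>

lemma vertices_LNode: "vertices (LNode r G) = insert r (set_mset (\<Sum>\<^sub># (image_mset labels G)))"
  by (simp add: vertices_def)

lemma finite_vertices [simp]: "finite (vertices L)"
  by (simp add: vertices_def)

lemma graft_cong: "(\<And>v. v \<in> vertices L \<Longrightarrow> f v = f' v) \<Longrightarrow> graft L f = graft L f'"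
proof (induction L)
  case (LNode r G)
  have "graft L f = graft L f'" if "L \<in># G" for L
    using that LNode.prems by (intro LNode.IH) (auto simp: vertices_def)
  then show ?case
    using LNode.prems by (auto simp: vertices_LNode cong: image_mset_cong)
qed

lemma graft_empty: "graft L (\<lambda>_. {#}) = shape L"
  by (induction L) (auto cong: image_mset_cong)

definition add_at :: "'b \<Rightarrow> 'v \<Rightarrow> ('v \<Rightarrow> 'b multiset) \<Rightarrow> 'v \<Rightarrow> 'b multiset" where
  "add_at s v \<phi> = \<phi>(v := add_mset s (\<phi> v))"

lemma add_at_commute: "add_at s v (add_at t u \<phi>) = add_at t u (add_at s v \<phi>)"
  by (auto simp: add_at_def fun_eq_iff)

text \<open>The share of the vertex \<open>v\<close> in growing \<open>s\<close> on a grafted tree: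
  \<open>s\<close> is hung at \<open>v\<close> itself or somewhere on one of the trees attached at
  \<open>v\<close>.\<close>

definition upd_sum :: "rtree \<Rightarrow> ('v \<Rightarrow> rtree multiset) \<Rightarrow> (('v \<Rightarrow> rtree multiset) \<Rightarrow> 'a) \<Rightarrow> 'v
    \<Rightarrow> 'a::comm_monoid_add" where
  "upd_sum s f k v = k (add_at s v f) + (\<Sum>A\<in>#deriv_mset (growths s) (f v). k (f(v := A)))"

lemma upd_sum_cong: "(\<And>A. k (f(v := A)) = k' (f(v := A))) \<Longrightarrow> upd_sum s f k v = upd_sum s f k' v"
  by (simp add: upd_sum_def add_at_def)

text \<open>The forest half of the induction for \<open>sum_growths_graft\<close>, whose statement
  for the members of \<open>G\<close> is the first hypothesis. Labels of different members are
  disjoint, so changing \<open>f\<close> at a vertex of one member leaves the other grafted members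
  as they are.\<close>

lemma sum_deriv_mset_graft:
  fixes k :: "rtree multiset \<Rightarrow> 'a::comm_monoid_add"
  assumes "\<And>L (h :: rtree \<Rightarrow> 'a). L \<in># G \<Longrightarrow>
      (\<Sum>w\<in>#growths s (graft L f). h w) = (\<Sum>v\<in>vertices L. upd_sum s f (\<lambda>\<phi>. h (graft L \<phi>)) v)"
    and "\<And>v. count (\<Sum>\<^sub># (image_mset labels G)) v \<le> 1"
  shows "(\<Sum>A\<in>#deriv_mset (growths s) (image_mset (\<lambda>L. graft L f) G). k A) =
      (\<Sum>v\<in>set_mset (\<Sum>\<^sub># (image_mset labels G)). upd_sum s f (\<lambda>\<phi>. k (image_mset (\<lambda>L. graft L \<phi>) G)) v)"
  using assms
proof (induction G arbitrary: k)
  case empty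
  then show ?case by simp
next
  case (add L G)
  let ?W = "set_mset (\<Sum>\<^sub># (image_mset labels G))"
  have cnt: "count (labels L) v + count (\<Sum>\<^sub># (image_mset labels G)) v \<le> 1" for v
    using add.prems(2)[of v] by simp
  have disj: "v \<in> vertices L \<Longrightarrow> v \<in> ?W \<Longrightarrow> False" for v
    using cnt[of v] unfolding vertices_def count_greater_zero_iff[symmetric] by linarith
  have dG: "count (\<Sum>\<^sub># (image_mset labels G)) v \<le> 1" for v
    using cnt[of v] by linarith
  have IH: "(\<Sum>A\<in>#deriv_mset (growths s) (image_mset (\<lambda>L. graft L f) G). k' A) =
      (\<Sum>v\<in>?W. upd_sum s f (\<lambda>\<phi>. k' (image_mset (\<lambda>L. graft L \<phi>) G)) v)" for k' :: "rtree multiset \<Rightarrow> 'a"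
    by (rule add.IH[OF add.prems(1) dG]) simp
  have "(\<Sum>A\<in>#deriv_mset (growths s) (image_mset (\<lambda>L. graft L f) G). k (add_mset (graft L f) A)) =
      (\<Sum>v\<in>?W. upd_sum s f (\<lambda>\<phi>. k (image_mset (\<lambda>L. graft L \<phi>) (add_mset L G))) v)"
    unfolding IH
  proof (intro sum.cong refl upd_sum_cong)
    fix v A assume "v \<in> ?W"
    then have "graft L (f(v := A)) = graft L f"
      using disj by (intro graft_cong) auto
    then show "k (add_mset (graft L f) (image_mset (\<lambda>L. graft L (f(v := A))) G)) =
        k (image_mset (\<lambda>L. graft L (f(v := A))) (add_mset L G))" by simp
  qed
  moreover have "(\<Sum>w\<in>#growths s (graft L f). k (add_mset w (image_mset (\<lambda>L. graft L f) G))) =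
      (\<Sum>v\<in>vertices L. upd_sum s f (\<lambda>\<phi>. k (image_mset (\<lambda>L. graft L \<phi>) (add_mset L G))) v)"
  proof (subst add.prems(1), simp, intro sum.cong refl upd_sum_cong)
    fix v A assume v: "v \<in> vertices L"
    have "graft L' (f(v := A)) = graft L' f" if "L' \<in># G" for L'
      using disj[OF v] that by (intro graft_cong) (auto simp: vertices_def)
    then show "k (add_mset (graft L (f(v := A))) (image_mset (\<lambda>L. graft L f) G)) =
        k (image_mset (\<lambda>L. graft L (f(v := A))) (add_mset L G))" by (simp cong: image_mset_cong)
  qed
  moreover have "set_mset (\<Sum>\<^sub># (image_mset labels (add_mset L G))) = vertices L \<union> ?W"
    by (simp add: vertices_def)
  moreover have "vertices L \<inter> ?W = {}"
    using disj by blast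
  ultimately show ?case
    by (simp add: sum_deriv_mset_add_mset sum.union_disjoint add_ac)
qed

text \<open>A vertex of \<open>graft L f\<close> is a vertex of \<open>L\<close> or lies in a tree
  attached at one of them; the right side sorts the growths by that vertex of \<open>L\<close>.
  Distinct labels make the set \<open>vertices L\<close> count every vertex.\<close>

lemma sum_growths_graft:
  fixes h :: "rtree \<Rightarrow> 'a::comm_monoid_add"
  assumes "distinct_labels L"
  shows "(\<Sum>w\<in>#growths s (graft L f). h w) = (\<Sum>v\<in>vertices L. upd_sum s f (\<lambda>\<phi>. h (graft L \<phi>)) v)"
  using assms
proof (induction L arbitrary: h)
  case (LNode r G)
  let ?W = "set_mset (\<Sum>\<^sub># (image_mset labels G))"
  let ?g = "\<lambda>\<phi>. image_mset (\<lambda>L. graft L \<phi>) G"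
  have cnt: "(if v = r then 1 else 0) + count (\<Sum>\<^sub># (image_mset labels G)) v \<le> 1" for v
    using LNode.prems unfolding distinct_labels_def by (auto dest: spec[of _ v])
  have r: "r \<notin> ?W"
    using cnt[of r] unfolding count_greater_zero_iff[symmetric] by simp
  have dG: "count (\<Sum>\<^sub># (image_mset labels G)) v \<le> 1" for v
    using cnt[of v] by linarith
  have dL: "distinct_labels L" if L: "L \<in># G" for L
  proof -
    obtain G' where "G = add_mset L G'"
      using L by (metis insert_DiffM)
    then show ?thesis
      using dG unfolding distinct_labels_def by (auto intro: order_trans[OF le_add1])
  qed
  have gr: "?g (f(r := A)) = ?g f" for A
    using r by (intro image_mset_cong graft_cong) (auto simp: vertices_def)
  have "(\<Sum>A\<in>#deriv_mset (growths s) (?g f). h (Node (A + f r))) =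
      (\<Sum>v\<in>?W. upd_sum s f (\<lambda>\<phi>. h (Node (?g \<phi> + f r))) v)"
    by (rule sum_deriv_mset_graft) (use LNode.IH dL dG in auto)
  also have "\<dots> = (\<Sum>v\<in>?W. upd_sum s f (\<lambda>\<phi>. h (graft (LNode r G) \<phi>)) v)"
    using r by (intro sum.cong refl upd_sum_cong) auto
  finally have 1: "(\<Sum>A\<in>#deriv_mset (growths s) (?g f). h (Node (A + f r))) = \<dots>" .
  \<comment> \<open>The first term and the growths inside \<open>f r\<close> make up the share of
    the root \<open>r\<close>; the growths inside the original subtrees belong to the other
    vertices.\<close>
  have "(\<Sum>w\<in>#growths s (graft (LNode r G) f). h w) =
     h (Node (add_mset s (?g f + f r))) + ((\<Sum>A\<in>#deriv_mset (growths s) (?g f). h (Node (A + f r)))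
       + (\<Sum>A\<in>#deriv_mset (growths s) (f r). h (Node (?g f + A))))"
    by (simp add: sum_growths_Node sum_deriv_mset_union)
  also have "\<dots> = upd_sum s f (\<lambda>\<phi>. h (graft (LNode r G) \<phi>)) r +
      (\<Sum>v\<in>?W. upd_sum s f (\<lambda>\<phi>. h (graft (LNode r G) \<phi>)) v)"
    unfolding 1 unfolding upd_sum_def add_at_def by (simp add: gr add_ac)
  also have "\<dots> = (\<Sum>v\<in>vertices (LNode r G). upd_sum s f (\<lambda>\<phi>. h (graft (LNode r G) \<phi>)) v)"
    unfolding vertices_LNode using r by (simp)
  finally show ?case .
qed

section \<open>Distributing a forest over vertices\<close>

definition attach :: "'v set \<Rightarrow> rtree multiset \<Rightarrow> ('v \<Rightarrow> rtree multiset) multiset" where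
  "attach V = fold_mset (\<lambda>s M. \<Sum>v\<in>V. image_mset (add_at s v) M) {#\<lambda>_. {#}#}"

lemma attach_empty [simp]: "attach V {#} = {#\<lambda>_. {#}#}"
  by (simp add: attach_def)

lemma attach_add_mset:
  "attach V (add_mset s F) = (\<Sum>v\<in>V. image_mset (add_at s v) (attach V F))"
proof -
  \<comment> \<open>Placing \<open>s\<close> and placing \<open>t\<close> commute, so the fold does
    not depend on an order of the forest.\<close>
  have "(\<Sum>v\<in>V. image_mset (add_at s v) (\<Sum>u\<in>V. image_mset (add_at t u) M)) =
      (\<Sum>u\<in>V. image_mset (add_at t u) (\<Sum>v\<in>V. image_mset (add_at s v) M))" for s t M
    unfolding image_mset_sum multiset.map_comp comp_def add_at_commute[of s _ t] by (rule sum.swap)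
  then interpret comp_fun_commute "\<lambda>s M. \<Sum>v\<in>V. image_mset (add_at s v) M"
    by unfold_locales (auto simp: fun_eq_iff)
  show ?thesis by (simp add: attach_def)
qed

lemma sum_attach_add_mset: "(\<Sum>\<phi>\<in>#attach V (add_mset s F). h \<phi>) =
    (\<Sum>\<phi>\<in>#attach V F. \<Sum>v\<in>V. (h (add_at s v \<phi>) :: 'a::comm_monoid_add))"
  by (simp add: attach_add_mset sum_mset_bind multiset.map_comp comp_def sum_mset_sum_swap)

text \<open>Each attached tree sits at exactly one vertex, so differentiating the attached forests
  vertex by vertex differentiates \<open>F\<close> as a whole: growing and attaching
  commute.\<close>

lemma sum_attach_deriv:
  fixes k :: "('v \<Rightarrow> rtree multiset) \<Rightarrow> 'a::comm_monoid_add"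
  assumes "finite V"
  shows "(\<Sum>\<phi>\<in>#attach V F. \<Sum>v\<in>V. \<Sum>A\<in>#deriv_mset g (\<phi> v). k (\<phi>(v := A))) =
    (\<Sum>F'\<in>#deriv_mset g F. \<Sum>\<phi>\<in>#attach V F'. k \<phi>)"
proof (induction F arbitrary: k)
  case empty
  then show ?case by simp
next
  case (add s F)
  have step: "(\<Sum>v\<in>V. \<Sum>A\<in>#deriv_mset g (add_at s u \<phi> v). k ((add_at s u \<phi>)(v := A))) =
      (\<Sum>v\<in>V. \<Sum>A\<in>#deriv_mset g (\<phi> v). k (add_at s u (\<phi>(v := A)))) + (\<Sum>s'\<in>#g s. k (add_at s' u \<phi>))"
    if u: "u \<in> V" for u \<phi>
  proof -
    \<comment> \<open>Away from \<open>u\<close> the two updates commute; at \<open>u\<close> the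
      Leibniz rule adds the terms in which \<open>s\<close> itself is replaced.\<close>
    have "(\<Sum>v\<in>V - {u}. \<Sum>A\<in>#deriv_mset g (add_at s u \<phi> v). k ((add_at s u \<phi>)(v := A))) =
      (\<Sum>v\<in>V - {u}. \<Sum>A\<in>#deriv_mset g (\<phi> v). k (add_at s u (\<phi>(v := A))))"
      by (intro sum.cong refl arg_cong[where f = sum_mset] image_mset_cong arg_cong[where f = k])
        (auto simp: add_at_def fun_upd_twist)
    moreover have "(\<Sum>A\<in>#deriv_mset g (add_at s u \<phi> u). k ((add_at s u \<phi>)(u := A))) =
      (\<Sum>A\<in>#deriv_mset g (\<phi> u). k (add_at s u (\<phi>(u := A)))) + (\<Sum>s'\<in>#g s. k (add_at s' u \<phi>))"
      by (simp add: add_at_def sum_deriv_mset_add_mset)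
    ultimately show ?thesis
      using assms u by (simp add: sum.remove[of V u] add_ac)
  qed
  have "(\<Sum>\<phi>\<in>#attach V (add_mset s F). \<Sum>v\<in>V. \<Sum>A\<in>#deriv_mset g (\<phi> v). k (\<phi>(v := A))) =
      (\<Sum>\<phi>\<in>#attach V F. \<Sum>u\<in>V. \<Sum>v\<in>V. \<Sum>A\<in>#deriv_mset g (add_at s u \<phi> v). k ((add_at s u \<phi>)(v := A)))"
    unfolding sum_attach_add_mset ..
  also have "\<dots> = (\<Sum>\<phi>\<in>#attach V F. \<Sum>u\<in>V.
      (\<Sum>v\<in>V. \<Sum>A\<in>#deriv_mset g (\<phi> v). k (add_at s u (\<phi>(v := A)))) + (\<Sum>s'\<in>#g s. k (add_at s' u \<phi>)))"
    by (intro arg_cong[where f = sum_mset] image_mset_cong sum.cong refl step)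
  also have "\<dots> = (\<Sum>\<phi>\<in>#attach V F. \<Sum>v\<in>V. \<Sum>A\<in>#deriv_mset g (\<phi> v). \<Sum>u\<in>V. k (add_at s u (\<phi>(v := A)))) +
      (\<Sum>s'\<in>#g s. \<Sum>\<phi>\<in>#attach V F. \<Sum>u\<in>V. k (add_at s' u \<phi>))"
  proof -
    have "(\<Sum>u\<in>V. \<Sum>v\<in>V. \<Sum>A\<in>#deriv_mset g (\<phi> v). k (add_at s u (\<phi>(v := A)))) =
        (\<Sum>v\<in>V. \<Sum>A\<in>#deriv_mset g (\<phi> v). \<Sum>u\<in>V. k (add_at s u (\<phi>(v := A))))" for \<phi>
      by (subst sum.swap) (simp add: sum_mset_sum_swap)
    moreover have "(\<Sum>\<phi>\<in>#attach V F. \<Sum>u\<in>V. \<Sum>s'\<in>#g s. k (add_at s' u \<phi>)) =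
        (\<Sum>s'\<in>#g s. \<Sum>\<phi>\<in>#attach V F. \<Sum>u\<in>V. k (add_at s' u \<phi>))"
      by (subst sum_mset.swap) (simp add: sum_mset_sum_swap)
    ultimately show ?thesis
      by (simp add: sum.distrib sum_mset.distrib)
  qed
  also have "\<dots> = (\<Sum>F'\<in>#deriv_mset g (add_mset s F). \<Sum>\<phi>\<in>#attach V F'. k \<phi>)"
    unfolding sum_deriv_mset_add_mset sum_attach_add_mset
      add.IH[of "\<lambda>\<phi>. \<Sum>u\<in>V. k (add_at s u \<phi>)"] ..
  finally show ?case .
qed

definition graftings :: "rtree multiset \<Rightarrow> rtree \<Rightarrow> rtree multiset" where
  "graftings F t = image_mset (graft (rep t)) (attach (vertices (rep t)) F)"

lemma graftings_empty [simp]: "graftings {#} t = {#t#}"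
  by (simp add: graftings_def graft_empty shape_rep)

text \<open>The two parts of \<open>upd_sum\<close> give the two sums on the right: hanging
  \<open>s\<close> at a vertex of \<open>t\<close> enlarges the forest, and growth inside an
  attached tree moves into \<open>F\<close> by \<open>sum_attach_deriv\<close>.\<close>

lemma sum_growths_graftings:
  fixes h :: "rtree \<Rightarrow> 'a::comm_monoid_add"
  shows "(\<Sum>w\<in>#graftings F t. \<Sum>z\<in>#growths s w. h z) =
    (\<Sum>w\<in>#graftings (add_mset s F) t. h w) +
    (\<Sum>F'\<in>#deriv_mset (growths s) F. \<Sum>w\<in>#graftings F' t. h w)"
proof -
  let ?V = "vertices (rep t)" and ?k = "\<lambda>\<phi>. h (graft (rep t) \<phi>)"
  have "(\<Sum>w\<in>#graftings F t. \<Sum>z\<in>#growths s w. h z) =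
      (\<Sum>\<phi>\<in>#attach ?V F. \<Sum>v\<in>?V. ?k (add_at s v \<phi>)) +
      (\<Sum>\<phi>\<in>#attach ?V F. \<Sum>v\<in>?V. \<Sum>A\<in>#deriv_mset (growths s) (\<phi> v). ?k (\<phi>(v := A)))"
    by (simp add: graftings_def multiset.map_comp comp_def sum_growths_graft distinct_labels_rep
        upd_sum_def sum.distrib sum_mset.distrib)
  then show ?thesis
    unfolding sum_attach_deriv[OF finite_vertices, where k = ?k]
    by (simp add: graftings_def multiset.map_comp comp_def sum_attach_add_mset)
qed

lemma sum_graftings_single:
  "(\<Sum>w\<in>#graftings {#s#} t. h w) = (\<Sum>w\<in>#growths s t. (h w :: 'a::comm_monoid_add))"
  using sum_growths_graftings[of h s "{#}" t] by simp

lemma graftings_e_tree: "graftings F e_tree = {#Node F#}"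
proof -
  obtain r where r: "rep e_tree = LNode r {#}"
    using shape_rep[of e_tree] by (cases "rep e_tree") (auto simp: e_tree_def)
  have "attach {r} F = {#(\<lambda>_. {#})(r := F)#}"
    by (induction F) (auto simp: attach_add_mset add_at_def fun_eq_iff)
  then show ?thesis
    by (simp add: graftings_def r vertices_def)
qed

text \<open>A function on \<open>insert x S\<close> is its value at \<open>x\<close> together with
  its restriction to \<open>S\<close>, which matches one step of \<open>attach\<close>. Subtrees of
  equal shape can make different \<open>g\<close> yield the same attachment; the multiset keeps that
  multiplicity.\<close>

lemma sum_attach_PiE:
  fixes h :: "('v \<Rightarrow> rtree multiset) \<Rightarrow> 'a::comm_monoid_add"
  assumes "finite V" "finite S"
  shows "(\<Sum>g\<in>S \<rightarrow>\<^sub>E V. h (\<lambda>v. shapes {x \<in> S. g x = v})) = (\<Sum>\<phi>\<in>#attach V (shapes S). h \<phi>)"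
  using assms(2)
proof (induction S arbitrary: h rule: finite_induct)
  case empty
  then show ?case by (simp add: shapes_def)
next
  case (insert x S)
  have *: "(\<lambda>v. shapes {y \<in> insert x S. (g(x := u)) y = v}) =
      add_at (shape x) u (\<lambda>v. shapes {y \<in> S. g y = v})" for g u
  proof
    fix v
    have "{y \<in> insert x S. (g(x := u)) y = v} =
        (if v = u then insert x {y \<in> S. g y = v} else {y \<in> S. g y = v})"
      using insert.hyps by auto
    then show "shapes {y \<in> insert x S. (g(x := u)) y = v} =
      add_at (shape x) u (\<lambda>v. shapes {y \<in> S. g y = v}) v"
      using insert.hyps by (simp add: shapes_def add_at_def)
  qed
  have "(\<Sum>g\<in>insert x S \<rightarrow>\<^sub>E V. h (\<lambda>v. shapes {y \<in> insert x S. g y = v})) =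
      (\<Sum>(u, g)\<in>V \<times> (S \<rightarrow>\<^sub>E V). h (\<lambda>v. shapes {y \<in> insert x S. (g(x := u)) y = v}))"
    unfolding PiE_insert_eq using insert.hyps
    by (subst sum.reindex[OF inj_combinator]) (auto simp: case_prod_unfold)
  also have "\<dots> = (\<Sum>g\<in>S \<rightarrow>\<^sub>E V. \<Sum>u\<in>V. h (add_at (shape x) u (\<lambda>v. shapes {y \<in> S. g y = v})))"
    unfolding * sum.cartesian_product[symmetric] by (rule sum.swap)
  also have "\<dots> = (\<Sum>\<phi>\<in>#attach V (shapes S). \<Sum>u\<in>V. h (add_at (shape x) u \<phi>))"
    by (rule insert.IH)
  also have "\<dots> = (\<Sum>\<phi>\<in>#attach V (add_mset (shape x) (shapes S)). h \<phi>)"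
    by (rule sum_attach_add_mset[symmetric])
  also have "add_mset (shape x) (shapes S) = shapes (insert x S)"
    using insert.hyps by (simp add: shapes_def)
  finally show ?case .
qed

section \<open>The unshuffle coproduct of a forest\<close>

definition splits :: "'b multiset \<Rightarrow> ('b multiset \<times> 'b multiset) multiset" where
  "splits = fold_mset (\<lambda>s M. image_mset (\<lambda>(a, b). (add_mset s a, b)) M +
     image_mset (\<lambda>(a, b). (a, add_mset s b)) M) {#({#}, {#})#}"

lemma splits_empty [simp]: "splits {#} = {#({#}, {#})#}"
  by (simp add: splits_def)

lemma splits_add_mset: "splits (add_mset s F) =
    image_mset (\<lambda>(a, b). (add_mset s a, b)) (splits F) +
    image_mset (\<lambda>(a, b). (a, add_mset s b)) (splits F)"
proof -
  interpret comp_fun_commute "\<lambda>s M. image_mset (\<lambda>(a, b). (add_mset s a, b)) M +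
      image_mset (\<lambda>(a, b). (a, add_mset s b)) M"
    by unfold_locales (auto simp: fun_eq_iff multiset.map_comp comp_def case_prod_unfold
        add_mset_commute add_ac)
  show ?thesis by (simp add: splits_def)
qed

lemma sum_splits_add_mset: "(\<Sum>p\<in>#splits (add_mset s F). h p) =
    (\<Sum>(a, b)\<in>#splits F. h (add_mset s a, b)) +
    (\<Sum>(a, b)\<in>#splits F. (h (a, add_mset s b) :: 'a::comm_monoid_add))"
  by (simp add: splits_add_mset multiset.map_comp comp_def case_prod_unfold)

lemma splits_union: "(a, b) \<in># splits F \<Longrightarrow> a + b = F"
  by (induction F arbitrary: a b) (auto simp: splits_add_mset)

text \<open>Coassociativity: both sides run over the ways of distributing \<open>F\<close> over
  three ordered parts.\<close>

lemma sum_splits_assoc: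
  fixes h :: "'b multiset \<Rightarrow> 'b multiset \<Rightarrow> 'b multiset \<Rightarrow> 'a::comm_monoid_add"
  shows "(\<Sum>(a, b)\<in>#splits F. \<Sum>(c, d)\<in>#splits a. h c d b) =
    (\<Sum>(a, b)\<in>#splits F. \<Sum>(c, d)\<in>#splits b. h a c d)"
proof (induction F arbitrary: h)
  case empty
  then show ?case by simp
next
  case (add s F)
  have "(\<Sum>(a, b)\<in>#splits F. \<Sum>(c, d)\<in>#splits (add_mset s a). h c d b) =
     (\<Sum>(a, b)\<in>#splits F. \<Sum>(c, d)\<in>#splits a. h (add_mset s c) d b) +
     (\<Sum>(a, b)\<in>#splits F. \<Sum>(c, d)\<in>#splits a. h c (add_mset s d) b)"
    by (simp add: case_prod_unfold sum_splits_add_mset sum_mset.distrib)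
  moreover have "(\<Sum>(a, b)\<in>#splits F. \<Sum>(c, d)\<in>#splits (add_mset s b). h a c d) =
     (\<Sum>(a, b)\<in>#splits F. \<Sum>(c, d)\<in>#splits b. h a (add_mset s c) d) +
     (\<Sum>(a, b)\<in>#splits F. \<Sum>(c, d)\<in>#splits b. h a c (add_mset s d))"
    by (simp add: case_prod_unfold sum_splits_add_mset sum_mset.distrib)
  ultimately show ?case
    by (simp add: sum_splits_add_mset add.IH add_ac)
qed

text \<open>The replaced element lies in exactly one of the two parts, so a derivation of multisets
  is also a coderivation for \<open>splits\<close>.\<close>

lemma sum_splits_deriv:
  fixes h :: "'b multiset \<Rightarrow> 'b multiset \<Rightarrow> 'a::comm_monoid_add"
  shows "(\<Sum>G\<in>#deriv_mset g F. \<Sum>(a, b)\<in>#splits G. h a b) =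
    (\<Sum>(a, b)\<in>#splits F. (\<Sum>a'\<in>#deriv_mset g a. h a' b) + (\<Sum>b'\<in>#deriv_mset g b. h a b'))"
proof (induction F arbitrary: h)
  case empty
  then show ?case by simp
next
  case (add s F)
  have "(\<Sum>w\<in>#g s. \<Sum>(a, b)\<in>#splits F. h (add_mset w a) b) =
      (\<Sum>(a, b)\<in>#splits F. \<Sum>w\<in>#g s. h (add_mset w a) b)"
    "(\<Sum>w\<in>#g s. \<Sum>(a, b)\<in>#splits F. h a (add_mset w b)) =
      (\<Sum>(a, b)\<in>#splits F. \<Sum>w\<in>#g s. h a (add_mset w b))"
    unfolding case_prod_unfold by (rule sum_mset.swap)+
  then show ?case
    using add.IH[of "\<lambda>a. h (add_mset s a)"] add.IH[of "\<lambda>a b. h a (add_mset s b)"]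
    by (simp add: sum_deriv_mset_add_mset sum_splits_add_mset sum_mset.distrib add_ac
        case_prod_unfold)
qed

lemma sum_splits_Pow:
  fixes h :: "rtree multiset \<Rightarrow> rtree multiset \<Rightarrow> 'a::comm_monoid_add"
  assumes "finite S"
  shows "(\<Sum>P\<in>Pow S. h (shapes P) (shapes (S - P))) = (\<Sum>(a, b)\<in>#splits (shapes S). h a b)"
  using assms
proof (induction S arbitrary: h rule: finite_induct)
  case empty
  then show ?case by (simp add: shapes_def)
next
  case (insert x S)
  have fin: "finite P" "x \<notin> P" "finite (S - P)" if "P \<in> Pow S" for P
    using that insert.hyps by (auto intro: finite_subset)
  have inj: "inj_on (insert x) (Pow S)"
    using insert.hyps by (auto simp: inj_on_def)
  have disj: "Pow S \<inter> insert x ` Pow S = {}"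
    using insert.hyps by auto
  \<comment> \<open>Sorting the subsets by whether they contain \<open>x\<close> mirrors the two
    summands in the recursion of \<open>splits\<close>.\<close>
  have "(\<Sum>P\<in>Pow (insert x S). h (shapes P) (shapes (insert x S - P))) =
     (\<Sum>P\<in>Pow S. h (shapes P) (shapes (insert x S - P))) +
     (\<Sum>P\<in>Pow S. h (shapes (insert x P)) (shapes (insert x S - insert x P)))"
    unfolding Pow_insert using insert.hyps
    by (subst sum.union_disjoint[OF _ _ disj]) (auto simp: sum.reindex[OF inj])
  also have "(\<Sum>P\<in>Pow S. h (shapes P) (shapes (insert x S - P))) =
     (\<Sum>P\<in>Pow S. h (shapes P) (add_mset (shape x) (shapes (S - P))))"
    using fin by (intro sum.cong refl) (auto simp: shapes_def insert_Diff_if insert.hyps)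
  also have "(\<Sum>P\<in>Pow S. h (shapes (insert x P)) (shapes (insert x S - insert x P))) =
     (\<Sum>P\<in>Pow S. h (add_mset (shape x) (shapes P)) (shapes (S - P)))"
  proof (intro sum.cong refl)
    fix P assume P: "P \<in> Pow S"
    then have "insert x S - insert x P = S - P" "shapes (insert x P) = add_mset (shape x) (shapes P)"
      using fin[OF P] insert.hyps by (auto simp: shapes_def)
    then show "h (shapes (insert x P)) (shapes (insert x S - insert x P)) =
      h (add_mset (shape x) (shapes P)) (shapes (S - P))" by simp
  qed
  finally have "(\<Sum>P\<in>Pow (insert x S). h (shapes P) (shapes (insert x S - P))) =
     (\<Sum>(a, b)\<in>#splits (add_mset (shape x) (shapes S)). h a b)"
    using insert.IH[of "\<lambda>a. h (add_mset (shape x) a)"]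
      insert.IH[of "\<lambda>a b. h a (add_mset (shape x) b)"]
    by (simp add: sum_splits_add_mset add_ac)
  also have "add_mset (shape x) (shapes S) = shapes (insert x S)"
    using insert.hyps by (simp add: shapes_def)
  finally show ?case .
qed

text \<open>Two equal children would repeat the label of their root. Distinct labels thus exclude
  repeated children, and passing to the set \<open>lchildren\<close> loses nothing.\<close>

lemma shapes_lchildren:
  assumes "distinct_labels L" "shape L = Node F"
  shows "finite (lchildren L)" "shapes (lchildren L) = F"
proof -
  obtain r G where L: "L = LNode r G" by (cases L)
  show "finite (lchildren L)" by (simp add: L)
  have "count G x \<le> 1" for x
  proof (rule ccontr)
    assume "\<not> count G x \<le> 1"
    then have "2 \<le> count G x" by simp
    then have "{#x, x#} \<subseteq># G"
      by (auto simp: subseteq_mset_def)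
    then obtain G' where "G = {#x, x#} + G'"
      by (auto simp: mset_subset_eq_exists_conv)
    moreover obtain v G'' where "x = LNode v G''" by (cases x)
    moreover have "count (labels (LNode r G)) v \<le> 1"
      using assms(1) unfolding L distinct_labels_def by blast
    ultimately show False
      by (auto split: if_splits)
  qed
  then have "mset_set (set_mset G) = G"
    by (intro multiset_eqI) (auto simp: count_mset_set' not_in_iff[symmetric] le_antisym)
  then show "shapes (lchildren L) = F"
    using assms(2) by (simp add: L shapes_def)
qed

section \<open>The product and the coproduct\<close>

abbreviation basis_vec :: "'b \<Rightarrow> ('b \<Rightarrow>\<^sub>0 'k::field)" where
  "basis_vec b \<equiv> Poly_Mapping.single b 1"

abbreviation lin :: "(('b \<Rightarrow>\<^sub>0 'k::field) \<Rightarrow> ('c \<Rightarrow>\<^sub>0 'k)) \<Rightarrow> bool" where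
  "lin \<equiv> Vector_Spaces.linear scale scale"

lemma linI:
  assumes "\<And>v w. f (v + w) = f v + f w" "\<And>c v. f (scale c v) = scale c (f v)"
  shows "lin f"
  unfolding Vector_Spaces.linear_def module_hom_def module_hom_axioms_def
  using assms by (auto intro: fvs.vector_space_axioms fvs.module_axioms)

lemma lin_add: "lin f \<Longrightarrow> f (v + w) = f v + f w"
  by (rule Vector_Spaces.linear.axioms(3)[THEN module_hom.add])

lemma lin_scale: "lin f \<Longrightarrow> f (scale c v) = scale c (f v)"
  by (rule Vector_Spaces.linear.axioms(3)[THEN module_hom.scale])

lemma lin_zero: "lin f \<Longrightarrow> f 0 = 0"
  by (rule Vector_Spaces.linear.axioms(3)[THEN module_hom.zero])

lemma lin_sum: "lin f \<Longrightarrow> f (\<Sum>x\<in>M. g x) = (\<Sum>x\<in>M. f (g x))"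
  by (induction M rule: infinite_finite_induct) (auto simp: lin_zero lin_add)

lemma lin_sum_mset: "lin f \<Longrightarrow> f (\<Sum>x\<in>#M. g x) = (\<Sum>x\<in>#M. f (g x))"
  by (induction M) (auto simp: lin_zero lin_add)

lemma lin_comp: "lin f \<Longrightarrow> lin g \<Longrightarrow> lin (\<lambda>v. f (g v))"
  by (rule linI) (simp_all add: lin_add lin_scale)

lemma lin_plus: "lin f \<Longrightarrow> lin g \<Longrightarrow> lin (\<lambda>v. f v + g v)"
  by (rule linI) (simp_all add: lin_add lin_scale fvs.scale_right_distrib)

lemma lin_ident: "lin (\<lambda>v. v)" and lin_id: "lin id"
  by (rule linI; simp)+

lemma scale_single [simp]: "scale c (Poly_Mapping.single b d) = Poly_Mapping.single b (c * d)"
  by (rule poly_mapping_eqI) (simp add: lookup_single when_def)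

lemma lin_ext_superset:
  assumes "finite B" "Poly_Mapping.keys v \<subseteq> B"
  shows "lin_ext f v = (\<Sum>b\<in>B. scale (Poly_Mapping.lookup v b) (f b))"
  unfolding lin_ext_def using assms
  by (intro sum.mono_neutral_left) (auto simp: in_keys_iff)

lemma lin_lin_ext:
  fixes f :: "'b \<Rightarrow> ('c \<Rightarrow>\<^sub>0 'k::field)"
  shows "lin (lin_ext f)"
proof (rule linI)
  fix v w :: "'b \<Rightarrow>\<^sub>0 'k" and c :: 'k
  let ?B = "Poly_Mapping.keys v \<union> Poly_Mapping.keys w"
  have "lin_ext f (v + w) = (\<Sum>b\<in>?B. scale (Poly_Mapping.lookup (v + w) b) (f b))"
    using Poly_Mapping.keys_add[of v w] by (intro lin_ext_superset) auto
  then show "lin_ext f (v + w) = lin_ext f v + lin_ext f w"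
    by (simp add: lin_ext_superset[of ?B] lookup_add fvs.scale_left_distrib sum.distrib)
  have "lin_ext f (scale c v) = (\<Sum>b\<in>Poly_Mapping.keys v. scale (Poly_Mapping.lookup (scale c v) b) (f b))"
    by (intro lin_ext_superset) (auto simp: in_keys_iff)
  then show "lin_ext f (scale c v) = scale c (lin_ext f v)"
    by (simp add: lin_ext_def fvs.scale_sum_right)
qed

lemma lin_ext_basis_vec [simp]: "lin_ext f (basis_vec b) = f b"
  by (simp add: lin_ext_def)

lemma lin_eqI:
  assumes "lin f" "lin g" "\<And>b. f (basis_vec b) = g (basis_vec b)"
  shows "f v = g v"
proof -
  have v: "v = (\<Sum>b\<in>Poly_Mapping.keys v. scale (Poly_Mapping.lookup v b) (basis_vec b))"
    by (rule poly_mapping_eqI) (simp add: lookup_sum lookup_single when_def in_keys_iff)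
  show ?thesis
    by (subst (1 2) v) (simp only: lin_sum[OF assms(1)] lin_sum[OF assms(2)]
      lin_scale[OF assms(1)] lin_scale[OF assms(2)] assms(3))
qed

lemma lookup_tens [simp]:
  "Poly_Mapping.lookup (v \<otimes>\<^sub>k w) (b, c) = Poly_Mapping.lookup v b * Poly_Mapping.lookup w c"
proof -
  have "Poly_Mapping.lookup (v \<otimes>\<^sub>k w) (b, c) = (\<Sum>b'\<in>Poly_Mapping.keys v. if b' = b then
      (\<Sum>c'\<in>Poly_Mapping.keys w. if c' = c then Poly_Mapping.lookup v b * Poly_Mapping.lookup w c else 0) else 0)"
    unfolding tens_def lookup_sum
    by (intro sum.cong refl) (auto simp: lookup_single when_def intro!: sum.cong sum.neutral)
  then show ?thesis by (auto simp: in_keys_iff)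
qed

lemma lin_tens_left: "lin (\<lambda>v. v \<otimes>\<^sub>k w)" and lin_tens_right: "lin (\<lambda>w. v \<otimes>\<^sub>k w)"
  by (rule linI; rule poly_mapping_eqI; auto simp: lookup_add algebra_simps)+

lemma tens_basis_vec [simp]: "basis_vec b \<otimes>\<^sub>k basis_vec c = basis_vec (b, c)"
  by (rule poly_mapping_eqI) (auto simp: lookup_single when_def split: if_splits)

lemma lin_tensor_map: "lin (tensor_map f g)"
  unfolding tensor_map_def by (rule lin_lin_ext)

lemma bilin_eqI:
  assumes "\<And>w. lin (\<lambda>v. f v w)" "\<And>w. lin (\<lambda>v. g v w)" "\<And>v. lin (f v)" "\<And>v. lin (g v)"
    and "\<And>b c. f (basis_vec b) (basis_vec c) = g (basis_vec b) (basis_vec c)"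
  shows "f v w = g v w"
proof (rule lin_eqI[of "\<lambda>v. f v w" "\<lambda>v. g v w"])
  show "f (basis_vec b) w = g (basis_vec b) w" for b
    by (rule lin_eqI[of "f (basis_vec b)" "g (basis_vec b)"]) (rule assms)+
qed (rule assms)+

lemma tensor_map_tens:
  assumes "lin f" "lin g"
  shows "tensor_map f g (v \<otimes>\<^sub>k w) = f v \<otimes>\<^sub>k g w"
proof (rule bilin_eqI[of "\<lambda>v w. tensor_map f g (v \<otimes>\<^sub>k w)" "\<lambda>v w. f v \<otimes>\<^sub>k g w"])
  show "tensor_map f g (basis_vec b \<otimes>\<^sub>k basis_vec c) = f (basis_vec b) \<otimes>\<^sub>k g (basis_vec c)" for b c
    by (simp add: tensor_map_def)
qed (rule lin_comp[OF lin_tensor_map lin_tens_left] lin_comp[OF lin_tensor_map lin_tens_right]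
    lin_comp[OF lin_tens_left assms(1)] lin_comp[OF lin_tens_right assms(2)])+

lemma lin_tensor_flip: "lin tensor_flip"
  unfolding tensor_flip_def by (rule lin_lin_ext)

lemma tensor_flip_tens: "tensor_flip (v \<otimes>\<^sub>k w) = w \<otimes>\<^sub>k v"
proof (rule bilin_eqI[of "\<lambda>v w. tensor_flip (v \<otimes>\<^sub>k w)" "\<lambda>v w. w \<otimes>\<^sub>k v"])
  show "tensor_flip (basis_vec b \<otimes>\<^sub>k basis_vec c) = basis_vec c \<otimes>\<^sub>k basis_vec b" for b c
    by (simp add: tensor_flip_def)
qed (rule lin_tens_left lin_tens_right lin_comp[OF lin_tensor_flip lin_tens_left]
    lin_comp[OF lin_tensor_flip lin_tens_right])+

lemma lin_GL_mult_lin: "lin GL_mult_lin"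
  unfolding GL_mult_lin_def by (rule lin_lin_ext)

lemma lin_GL_mult_left: "lin (\<lambda>a. a \<star> b)" and lin_GL_mult_right: "lin (\<lambda>b. a \<star> b)"
  unfolding GL_mult_def
  by (rule lin_comp[OF lin_GL_mult_lin lin_tens_left] lin_comp[OF lin_GL_mult_lin lin_tens_right])+

lemmas GL_mult_linear =
  lin_add[OF lin_GL_mult_left] lin_add[OF lin_GL_mult_right]
  lin_scale[OF lin_GL_mult_left] lin_scale[OF lin_GL_mult_right]
  lin_zero[OF lin_GL_mult_left] lin_zero[OF lin_GL_mult_right]
  lin_sum[OF lin_GL_mult_left] lin_sum[OF lin_GL_mult_right]
  lin_sum_mset[OF lin_GL_mult_left] lin_sum_mset[OF lin_GL_mult_right]

lemma lin_GL_comult: "lin GL_comult"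
  unfolding GL_comult_def by (rule lin_lin_ext)

lemma lin_natural_growth: "lin natural_growth"
  unfolding natural_growth_def by (rule lin_lin_ext)

section \<open>Product and coproduct of trees, associativity\<close>

lemma basis_vec_mult: "basis_vec (Node F) \<star> basis_vec t = (\<Sum>w\<in>#graftings F t. basis_vec w)"
proof -
  have "basis_vec (Node F) \<star> basis_vec t = tree_mult (Node F) t"
    by (simp add: GL_mult_def GL_mult_lin_def)
  also have "\<dots> = (\<Sum>w\<in>#graftings F t. basis_vec w)"
    unfolding tree_mult_def
    by (subst sum_attach_PiE[where h = "\<lambda>\<phi>. basis_vec (graft (rep t) \<phi>)"])
      (auto simp: graftings_def multiset.map_comp comp_def
        shapes_lchildren[OF distinct_labels_rep shape_rep])
  finally show ?thesis .
qed

lemma primitive_mult: "basis_vec (Node {#s#}) \<star> basis_vec t = (\<Sum>w\<in>#growths s t. basis_vec w)"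
  by (simp add: basis_vec_mult sum_graftings_single)

lemma GL_comult_basis_vec:
  "GL_comult (basis_vec (Node F)) = (\<Sum>(a, b)\<in>#splits F. basis_vec (Node a) \<otimes>\<^sub>k basis_vec (Node b))"
  unfolding GL_comult_def lin_ext_basis_vec tree_comult_def
  by (subst sum_splits_Pow[where h = "\<lambda>a b. basis_vec (Node a, Node b)"])
    (simp_all add: shapes_lchildren[OF distinct_labels_rep shape_rep])

lemma GL_mult_unit_left: "GL_unit \<star> a = a" and GL_mult_unit_right: "a \<star> GL_unit = a"
proof -
  show "GL_unit \<star> a = a"
    by (rule lin_eqI[OF lin_GL_mult_right lin_ident]) (simp add: GL_unit_def e_tree_def basis_vec_mult)
  have "basis_vec t \<star> GL_unit = basis_vec t" for t :: rtree
    by (cases t) (simp add: GL_unit_def basis_vec_mult graftings_e_tree)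
  then show "a \<star> GL_unit = a"
    by (rule lin_eqI[OF lin_GL_mult_left lin_ident])
qed

text \<open>On trees this is \<open>sum_growths_graftings\<close> for the test function
  \<open>basis_vec\<close>: the product of \<open>Node {#s#}\<close> and \<open>Node F\<close>
  yields exactly the forests that occur on its right-hand side.\<close>

lemma primitive_mult_assoc:
  "(basis_vec (Node {#s#}) \<star> b) \<star> c = basis_vec (Node {#s#}) \<star> (b \<star> c)"
proof (rule bilin_eqI[of "\<lambda>b c. (basis_vec (Node {#s#}) \<star> b) \<star> c"
      "\<lambda>b c. basis_vec (Node {#s#}) \<star> (b \<star> c)"])
  fix t u :: rtree
  obtain F where t: "t = Node F" by (cases t)
  show "(basis_vec (Node {#s#}) \<star> basis_vec t) \<star> basis_vec u =
      basis_vec (Node {#s#}) \<star> (basis_vec t \<star> basis_vec u)"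
    by (simp add: t primitive_mult GL_mult_linear sum_growths_Node basis_vec_mult[of _ u] sum_growths_graftings)
qed (rule lin_GL_mult_right lin_comp[OF lin_GL_mult_left lin_GL_mult_right]
    lin_comp[OF lin_GL_mult_right lin_GL_mult_left]
    lin_comp[OF lin_GL_mult_left lin_GL_mult_left] lin_comp[OF lin_GL_mult_right lin_GL_mult_right])+

text \<open>
  Up to trees with fewer root children, every tree is a product with a primitive one, so that
  associativity reduces to the case where the first factor is primitive.
\<close>

lemma GL_mult_assoc: "(a \<star> b) \<star> c = a \<star> (b \<star> (c :: 'k::field GL))"
proof -
  have *: "(basis_vec (Node F) \<star> b) \<star> c = basis_vec (Node F) \<star> (b \<star> c)" for F
  proof (induction "size F" arbitrary: F rule: less_induct)
    case less
    show ?case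
    proof (cases F)
      case empty
      have "basis_vec (Node {#}) = (GL_unit :: 'k GL)"
        by (simp add: GL_unit_def e_tree_def)
      then show ?thesis by (simp add: empty GL_mult_unit_left)
    next
      case (add s G)
      define p :: "'k GL" where "p = basis_vec (Node {#s#})"
      define R :: "'k GL" where "R = (\<Sum>A\<in>#deriv_mset (growths s) G. basis_vec (Node A))"
      have F: "basis_vec (Node F) + R = p \<star> basis_vec (Node G)"
        by (simp add: p_def R_def add primitive_mult sum_growths_Node)
      \<comment> \<open>All trees in \<open>R\<close> have \<open>size G\<close> root children, one
        fewer than \<open>Node F\<close>, so the induction hypothesis covers them.\<close>
      have "(R \<star> b) \<star> c = R \<star> (b \<star> c)"
        unfolding R_def GL_mult_linear
        by (intro arg_cong[where f = sum_mset] image_mset_cong less) (auto dest: size_deriv_mset simp: add)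
      \<comment> \<open>The sum is a product with the primitive \<open>p\<close>, so
        \<open>primitive_mult_assoc\<close> leaves only the smaller tree \<open>Node G\<close> to be
        reassociated. Cancelling \<open>R\<close> then isolates \<open>Node F\<close>.\<close>
      moreover have "((basis_vec (Node F) + R) \<star> b) \<star> c = (basis_vec (Node F) + R) \<star> (b \<star> c)"
        unfolding F p_def primitive_mult_assoc by (subst less) (simp_all add: add)
      ultimately show ?thesis
        by (simp add: GL_mult_linear)
    qed
  qed
  show ?thesis
  proof (rule lin_eqI[of "\<lambda>a. (a \<star> b) \<star> c" "\<lambda>a. a \<star> (b \<star> c)"])
    show "(basis_vec t \<star> b) \<star> c = basis_vec t \<star> (b \<star> c)" for t
      using * by (cases t) simp
  qed (rule lin_GL_mult_left lin_comp[OF lin_GL_mult_left lin_GL_mult_left])+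
qed

text \<open>With nothing attached yet, the derivative part of \<open>upd_sum\<close> is empty, and
  what remains at each vertex of \<open>rep t\<close> is the summand of
  \<open>tree_growth\<close>.\<close>

lemma natural_growth_eq_mult: "natural_growth a = basis_vec (Node {#e_tree#}) \<star> a"
proof (rule lin_eqI[OF lin_natural_growth lin_GL_mult_right])
  fix t
  have "tree_growth t = (\<Sum>v\<in>vertices (rep t). upd_sum e_tree (\<lambda>_. {#}) (\<lambda>\<phi>. basis_vec (graft (rep t) \<phi>)) v)"
    unfolding tree_growth_def
    by (intro sum.cong refl) (auto simp: upd_sum_def add_at_def fun_upd_def)
  also have "\<dots> = (\<Sum>w\<in>#growths e_tree (graft (rep t) (\<lambda>_. {#})). basis_vec w)"
    by (rule sum_growths_graft[symmetric]) (rule distinct_labels_rep)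
  finally show "natural_growth (basis_vec t) = basis_vec (Node {#e_tree#}) \<star> basis_vec t"
    by (simp add: natural_growth_def primitive_mult graft_empty shape_rep)
qed

lemma natural_growth_basis_vec: "natural_growth (basis_vec t) = (\<Sum>w\<in>#growths e_tree t. basis_vec w)"
  by (simp add: natural_growth_eq_mult primitive_mult)

lemma natural_growth_mult: "natural_growth a \<star> b = natural_growth (a \<star> b)"
  by (simp add: natural_growth_eq_mult GL_mult_assoc)

definition tensor_growth :: "(rtree \<times> rtree \<Rightarrow>\<^sub>0 'k::field) \<Rightarrow> (rtree \<times> rtree \<Rightarrow>\<^sub>0 'k)" where
  "tensor_growth v = tensor_map natural_growth id v + tensor_map id natural_growth v"

lemma lin_tensor_growth: "lin tensor_growth"
  unfolding tensor_growth_def by (intro lin_plus lin_tensor_map)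

lemma tensor_growth_tens: "tensor_growth (a \<otimes>\<^sub>k b) = natural_growth a \<otimes>\<^sub>k b + a \<otimes>\<^sub>k natural_growth b"
  by (simp add: tensor_growth_def tensor_map_tens lin_natural_growth lin_id)

text \<open>Natural growth is a coderivation. A new leaf below the root joins either part of the
  split; a leaf placed deeper changes one child, which stays in its part by
  \<open>sum_splits_deriv\<close>. Taken together, the changes to one part are the growths of its
  tree.\<close>

lemma GL_comult_natural_growth: "GL_comult (natural_growth a) = tensor_growth (GL_comult a)"
proof (rule lin_eqI[OF lin_comp[OF lin_GL_comult lin_natural_growth] lin_comp[OF lin_tensor_growth lin_GL_comult]])
  fix t :: rtree
  obtain F where t: "t = Node F" by (cases t)
  have "GL_comult (natural_growth (basis_vec t)) = GL_comult (basis_vec (Node (add_mset e_tree F))) +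
      (\<Sum>G\<in>#deriv_mset (growths e_tree) F. GL_comult (basis_vec (Node G)))"
    by (simp add: t natural_growth_basis_vec lin_sum_mset[OF lin_GL_comult] lin_add[OF lin_GL_comult] sum_growths_Node)
  also have "\<dots> = tensor_growth (GL_comult (basis_vec t))"
    unfolding t GL_comult_basis_vec sum_splits_deriv sum_splits_add_mset lin_sum_mset[OF lin_tensor_growth]
    by (simp add: case_prod_unfold tensor_growth_tens[unfolded tens_basis_vec] natural_growth_basis_vec sum_growths_Node
        lin_add[OF lin_tens_left] lin_add[OF lin_tens_right] lin_sum_mset[OF lin_tens_left]
        lin_sum_mset[OF lin_tens_right] sum_mset.distrib add_ac
       del: tens_basis_vec)
  finally show "GL_comult (natural_growth (basis_vec t)) = tensor_growth (GL_comult (basis_vec t))" .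
qed

section \<open>The antipode and powers of natural growth\<close>

text \<open>Convolution of linear endomorphisms, each encoded by its values on the trees
  \<open>Node F\<close> and hence indexed by forests.\<close>

definition conv :: "(rtree multiset \<Rightarrow> 'k::field GL) \<Rightarrow> (rtree multiset \<Rightarrow> 'k GL) \<Rightarrow>
    rtree multiset \<Rightarrow> 'k GL" where
  "conv \<sigma> \<tau> F = (\<Sum>(a, b)\<in>#splits F. \<sigma> a \<star> \<tau> b)"

definition conv_unit :: "rtree multiset \<Rightarrow> 'k::field GL" where
  "conv_unit F = (if F = {#} then GL_unit else 0)"

text \<open>The identity minus the convolution unit. It vanishes on \<open>e\<close>, which makes
  its powers locally nilpotent.\<close>

definition aug :: "rtree multiset \<Rightarrow> 'k::field GL" where
  "aug F = (if F = {#} then 0 else basis_vec (Node F))"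

lemma GL_unit_eq: "GL_unit = basis_vec (Node {#})"
  by (simp add: GL_unit_def e_tree_def)

lemma basis_vec_Node: "basis_vec (Node F) = aug F + conv_unit F"
  by (simp add: aug_def conv_unit_def GL_unit_eq)

lemma conv_assoc: "conv (conv \<rho> \<sigma>) \<tau> F = conv \<rho> (conv \<sigma> \<tau>) F"
proof -
  have "conv (conv \<rho> \<sigma>) \<tau> F = (\<Sum>(a, b)\<in>#splits F. \<Sum>(c, d)\<in>#splits a. \<rho> c \<star> \<sigma> d \<star> \<tau> b)"
    by (simp add: conv_def GL_mult_linear case_prod_unfold)
  also have "\<dots> = (\<Sum>(a, b)\<in>#splits F. \<Sum>(c, d)\<in>#splits b. \<rho> a \<star> \<sigma> c \<star> \<tau> d)"
    by (rule sum_splits_assoc)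
  also have "\<dots> = conv \<rho> (conv \<sigma> \<tau>) F"
    by (simp add: conv_def GL_mult_linear case_prod_unfold GL_mult_assoc)
  finally show ?thesis .
qed

text \<open>The counit law for \<open>splits\<close>: exactly one split has an empty left part, and
  its right part is all of \<open>F\<close>.\<close>

lemma sum_splits_left_empty:
  "(\<Sum>(a, b)\<in>#splits F. if a = {#} then h b else 0) = (h F :: 'a::comm_monoid_add)"
proof (induction F arbitrary: h)
  case (add s F)
  show ?case
    using add.IH[of "\<lambda>b. h (add_mset s b)"] by (simp add: sum_splits_add_mset case_prod_unfold cong: if_cong)
qed simp

lemma sum_splits_right_empty:
  "(\<Sum>(a, b)\<in>#splits F. if b = {#} then h a else 0) = (h F :: 'a::comm_monoid_add)"
proof (induction F arbitrary: h)
  case (add s F)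
  show ?case
    using add.IH[of "\<lambda>b. h (add_mset s b)"] by (simp add: sum_splits_add_mset case_prod_unfold cong: if_cong)
qed simp

lemma conv_unit_left: "conv conv_unit \<tau> F = \<tau> F"
proof -
  have "conv conv_unit \<tau> F = (\<Sum>(a, b)\<in>#splits F. if a = {#} then \<tau> b else 0)"
    unfolding conv_def conv_unit_def
    by (intro arg_cong[where f = sum_mset] image_mset_cong)
      (auto simp: GL_mult_unit_left GL_mult_linear)
  then show ?thesis by (simp only: sum_splits_left_empty)
qed

lemma conv_unit_right: "conv \<tau> conv_unit F = \<tau> F"
proof -
  have "conv \<tau> conv_unit F = (\<Sum>(a, b)\<in>#splits F. if b = {#} then \<tau> a else 0)"
    unfolding conv_def conv_unit_def
    by (intro arg_cong[where f = sum_mset] image_mset_cong)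
      (auto simp: GL_mult_unit_right GL_mult_linear)
  then show ?thesis by (simp only: sum_splits_right_empty)
qed

text \<open>The hypothesis compares products instead of factors, and only for parts of
  \<open>F\<close>, so that size bounds on the parts may enter.\<close>

lemma conv_cong:
  assumes "\<And>a b. a + b = F \<Longrightarrow> \<sigma> a \<star> \<tau> b = \<sigma>' a \<star> \<tau>' b"
  shows "conv \<sigma> \<tau> F = conv \<sigma>' \<tau>' F"
  unfolding conv_def
  by (intro arg_cong[where f = sum_mset] image_mset_cong) (auto dest: splits_union intro: assms)

lemma conv_add_right: "conv \<sigma> (\<lambda>b. \<tau> b + \<tau>' b) F = conv \<sigma> \<tau> F + conv \<sigma> \<tau>' F"
  by (simp add: conv_def GL_mult_linear case_prod_unfold sum_mset.distrib)

lemma conv_add_left: "conv (\<lambda>b. \<sigma> b + \<sigma>' b) \<tau> F = conv \<sigma> \<tau> F + conv \<sigma>' \<tau> F"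
  by (simp add: conv_def GL_mult_linear case_prod_unfold sum_mset.distrib)

lemma scale_sum_mset: "scale c (\<Sum>x\<in>#M. f x) = (\<Sum>x\<in>#M. scale c (f x))"
  by (induction M) (auto simp: fvs.scale_right_distrib)

lemma conv_sum_left:
  "conv (\<lambda>a. \<Sum>n\<in>N. scale (c n) (f n a)) \<tau> F = (\<Sum>n\<in>N. scale (c n) (conv (f n) \<tau> F))"
  by (simp add: conv_def GL_mult_linear case_prod_unfold sum_mset_sum_swap scale_sum_mset)

lemma conv_sum_right:
  "conv \<tau> (\<lambda>a. \<Sum>n\<in>N. scale (c n) (f n a)) F = (\<Sum>n\<in>N. scale (c n) (conv \<tau> (f n) F))"
  by (simp add: conv_def GL_mult_linear case_prod_unfold sum_mset_sum_swap scale_sum_mset)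

primrec aug_pow :: "nat \<Rightarrow> rtree multiset \<Rightarrow> 'k::field GL" where
  "aug_pow 0 = conv_unit"
| "aug_pow (Suc n) = conv (aug_pow n) aug"

text \<open>The recursion puts the new \<open>aug\<close> on the right; the right inverse in
  \<open>conv_geom_right\<close> calls for it on the left.\<close>

lemma aug_pow_Suc_left: "(aug_pow (Suc n) :: _ \<Rightarrow> 'k::field GL) = conv aug (aug_pow n)"
proof (induction n)
  case 0
  show ?case by (simp add: fun_eq_iff conv_unit_left conv_unit_right)
next
  case (Suc n)
  have "(aug_pow (Suc (Suc n)) :: _ \<Rightarrow> 'k GL) = conv (conv aug (aug_pow n)) aug"
    by (subst aug_pow.simps(2), subst Suc) (rule refl)
  also have "\<dots> = conv aug (aug_pow (Suc n))"
    by (simp add: fun_eq_iff conv_assoc)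
  finally show ?case .
qed

text \<open>Since \<open>aug\<close> kills the empty forest, a nonzero term of the
  \<open>n\<close>-th power comes from \<open>n\<close> nonempty parts of \<open>F\<close>.\<close>

lemma aug_pow_eq_0: "size F < n \<Longrightarrow> aug_pow n F = (0 :: 'k::field GL)"
proof (induction n arbitrary: F)
  case (Suc n)
  have "aug_pow n a \<star> aug b = (0 :: 'k GL)" if "a + b = F" for a b
  proof (cases "b = {#}")
    case False
    then have "size a < n" using that Suc.prems by (auto simp: nonempty_has_size)
    then show ?thesis by (simp add: Suc.IH GL_mult_linear)
  qed (simp add: aug_def GL_mult_linear)
  then have "aug_pow (Suc n) F = conv (\<lambda>_. 0) (\<lambda>_. 0 :: 'k GL) F"
    unfolding aug_pow.simps by (intro conv_cong) (simp add: GL_mult_linear)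
  then show ?case by (simp add: conv_def GL_mult_linear case_prod_unfold)
qed simp

text \<open>The geometric series for the convolution inverse of the identity \<open>conv_unit + aug\<close>.\<close>

definition geom :: "rtree multiset \<Rightarrow> 'k::field GL" where
  "geom F = (\<Sum>n\<le>size F. scale ((- 1) ^ n) (aug_pow n F))"

text \<open>A convolution evaluates \<open>geom\<close> on forests of various sizes; a common bound
  \<open>N\<close> is needed before the sum over \<open>n\<close> can be moved out.\<close>

lemma geom_eq: "size F \<le> N \<Longrightarrow> geom F = (\<Sum>n\<le>N. scale ((- 1) ^ n) (aug_pow n F))"
  unfolding geom_def by (rule sum.mono_neutral_left) (auto simp: aug_pow_eq_0)

lemma geom_step:
  "geom F + (\<Sum>n\<le>size F. scale ((- 1) ^ n) (aug_pow (Suc n) F)) = (conv_unit F :: 'k::field GL)"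
proof -
  \<comment> \<open>The extra term at \<open>Suc (size F)\<close> is zero and makes room for the
    index shift.\<close>
  have "(geom F :: 'k GL) = (\<Sum>n\<le>Suc (size F). scale ((- 1) ^ n) (aug_pow n F))"
    by (rule geom_eq) simp
  also have "\<dots> = conv_unit F + (\<Sum>n\<le>size F. scale ((- 1) ^ Suc n) (aug_pow (Suc n) F))"
    by (subst sum.atMost_Suc_shift) simp
  finally show ?thesis
    by (simp add: fvs.scale_minus_left sum_negf del: aug_pow.simps(2))
qed

lemma conv_geom_left: "conv geom (\<lambda>F. basis_vec (Node F)) F = (conv_unit F :: 'k::field GL)"
proof -
  have "(conv geom aug F :: 'k GL) = conv (\<lambda>a. \<Sum>n\<le>size F. scale ((- 1) ^ n) (aug_pow n a)) aug F"
    by (rule conv_cong, subst geom_eq[where N = "size F"]) auto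
  then show ?thesis
    using geom_step[of F, where 'k = 'k]
    by (simp add: basis_vec_Node conv_add_right conv_unit_right conv_sum_left add.commute)
qed

lemma conv_geom_right: "conv (\<lambda>F. basis_vec (Node F)) geom F = (conv_unit F :: 'k::field GL)"
proof -
  have "(conv aug geom F :: 'k GL) = conv aug (\<lambda>a. \<Sum>n\<le>size F. scale ((- 1) ^ n) (aug_pow n a)) F"
    by (rule conv_cong, subst geom_eq[where N = "size F"]) auto
  then show ?thesis
    using geom_step[of F, where 'k = 'k]
    by (simp add: basis_vec_Node conv_add_left conv_unit_left conv_sum_right add.commute aug_pow_Suc_left
        del: aug_pow.simps(2))
qed

section \<open>Existence and uniqueness of the antipode\<close>

lemma conv_unit_eq_counit: "conv_unit F = scale (GL_counit (basis_vec (Node F))) GL_unit"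
  by (auto simp: conv_unit_def GL_counit_def lookup_single e_tree_def when_def)

lemma GL_mult_lin_tens: "GL_mult_lin (a \<otimes>\<^sub>k b) = a \<star> b"
  by (simp add: GL_mult_def)

lemma antipode_conv:
  assumes "lin S"
  shows "GL_mult_lin (tensor_map S id (GL_comult (basis_vec (Node F)))) =
      conv (\<lambda>F. S (basis_vec (Node F))) (\<lambda>F. basis_vec (Node F)) F"
    and "GL_mult_lin (tensor_map id S (GL_comult (basis_vec (Node F)))) =
      conv (\<lambda>F. basis_vec (Node F)) (\<lambda>F. S (basis_vec (Node F))) F"
  by (simp_all add: GL_comult_basis_vec conv_def case_prod_unfold GL_mult_lin_tens
      lin_sum_mset[OF lin_tensor_map] lin_sum_mset[OF lin_GL_mult_lin]
      tensor_map_tens[OF assms lin_id] tensor_map_tens[OF lin_id assms] del: tens_basis_vec)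

lemma lin_counit: "lin (\<lambda>a. scale (GL_counit a) GL_unit)"
  by (rule linI) (simp_all add: GL_counit_def lookup_add fvs.scale_left_distrib)

text \<open>Both axioms equate linear maps, so their values on trees decide; there they say that
  \<open>S\<close> is a two-sided convolution inverse of the identity.\<close>

lemma is_GL_antipode_iff:
  "is_GL_antipode S \<longleftrightarrow> lin S \<and>
     conv (\<lambda>F. S (basis_vec (Node F))) (\<lambda>F. basis_vec (Node F)) = conv_unit \<and>
     conv (\<lambda>F. basis_vec (Node F)) (\<lambda>F. S (basis_vec (Node F))) = conv_unit"
  (is "_ \<longleftrightarrow> lin S \<and> ?L \<and> ?R")
proof (cases "lin S")
  case True
  have *: "(\<forall>a. f a = scale (GL_counit a) GL_unit) \<longleftrightarrow>
      (\<forall>F. f (basis_vec (Node F)) = conv_unit F)" if "lin f" for f :: "'a GL \<Rightarrow> 'a GL"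
  proof
    assume F: "\<forall>F. f (basis_vec (Node F)) = conv_unit F"
    have "f (basis_vec t) = scale (GL_counit (basis_vec t)) GL_unit" for t
      using F by (cases t) (simp add: conv_unit_eq_counit)
    then show "\<forall>a. f a = scale (GL_counit a) GL_unit"
      using lin_eqI[OF that lin_counit] by blast
  qed (simp add: conv_unit_eq_counit)
  have lin: "lin (\<lambda>a. GL_mult_lin (tensor_map f g (GL_comult a)))" for f g :: "'a GL \<Rightarrow> 'a GL"
    by (rule lin_comp[OF lin_GL_mult_lin lin_comp[OF lin_tensor_map lin_GL_comult]])
  show ?thesis
    unfolding is_GL_antipode_def all_conj_distrib *[OF lin] antipode_conv[OF True] fun_eq_iff ..
qed (simp add: is_GL_antipode_def)

lemma is_GL_antipode_GL_antipode: "is_GL_antipode (GL_antipode :: 'k::field GL \<Rightarrow> 'k GL)"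
proof -
  define S :: "'k GL \<Rightarrow> 'k GL" where "S = lin_ext (\<lambda>t. case t of Node F \<Rightarrow> geom F)"
  have "is_GL_antipode S"
    unfolding is_GL_antipode_iff
    by (simp add: S_def lin_lin_ext fun_eq_iff conv_geom_left conv_geom_right)
  moreover have "S' = T" if S': "is_GL_antipode S'" and T: "is_GL_antipode T" for S' T :: "'k GL \<Rightarrow> 'k GL"
  proof
    fix a
    have "S' (basis_vec (Node F)) = T (basis_vec (Node F))" for F
    proof -
      let ?i = "\<lambda>F. basis_vec (Node F) :: 'k GL"
      \<comment> \<open>The product of \<open>S'\<close>, the identity and \<open>T\<close> is
        bracketed in two ways.\<close>
      have "S' (?i F) = conv (\<lambda>F. S' (?i F)) (conv ?i (\<lambda>F. T (?i F))) F"
        using T by (simp add: is_GL_antipode_iff conv_unit_right)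
      also have "\<dots> = conv (conv (\<lambda>F. S' (?i F)) ?i) (\<lambda>F. T (?i F)) F"
        by (rule conv_assoc[symmetric])
      also have "\<dots> = T (?i F)"
        using S' by (simp add: is_GL_antipode_iff conv_unit_left)
      finally show ?thesis .
    qed
    then have "S' (basis_vec t) = T (basis_vec t)" for t
      by (cases t) simp
    then show "S' a = T a"
      using S' T lin_eqI[of S' T] by (simp add: is_GL_antipode_iff)
  qed
  ultimately show ?thesis
    unfolding GL_antipode_def by (metis (mono_tags, lifting) theI)
qed

lemma lin_GL_antipode: "lin GL_antipode"
  using is_GL_antipode_GL_antipode unfolding is_GL_antipode_def by blast

lemma GL_antipode_left:
  "GL_mult_lin (tensor_map GL_antipode id (GL_comult a)) = scale (GL_counit a) GL_unit"
  using is_GL_antipode_GL_antipode unfolding is_GL_antipode_def by blast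

section \<open>Powers of natural growth\<close>

definition growth_seq :: "nat \<Rightarrow> 'k::field GL" where
  "growth_seq j = (natural_growth ^^ j) GL_unit"

lemma growth_seq_0: "growth_seq 0 = GL_unit"
  and growth_seq_Suc: "growth_seq (Suc j) = natural_growth (growth_seq j)"
  by (simp_all add: growth_seq_def)

lemma growth_seq_mult: "growth_seq m \<star> growth_seq n = growth_seq (m + n)"
  by (induction m) (simp_all add: growth_seq_0 growth_seq_Suc GL_mult_unit_left natural_growth_mult)

text \<open>The coderivation \<open>tensor_growth\<close> raises one index of each tensor in the
  formula for \<open>m\<close>; collecting equal tensors is Pascal's rule.\<close>

lemma GL_comult_growth_seq:
  "GL_comult (growth_seq m) =
     (\<Sum>i\<le>m. scale (of_nat (m choose i)) (growth_seq i \<otimes>\<^sub>k growth_seq (m - i)))"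
proof (induction m)
  case 0
  have "GL_comult (GL_unit :: 'a GL) = GL_unit \<otimes>\<^sub>k GL_unit"
    by (simp add: GL_unit_eq GL_comult_basis_vec)
  then show ?case by (simp add: growth_seq_0)
next
  case (Suc m)
  let ?x = "growth_seq :: nat \<Rightarrow> 'a GL"
  let ?T = "\<lambda>i. ?x i \<otimes>\<^sub>k ?x (Suc m - i)"
  have "GL_comult (?x (Suc m)) =
      (\<Sum>i\<le>m. scale (of_nat (m choose i)) (?x (Suc i) \<otimes>\<^sub>k ?x (m - i) + ?x i \<otimes>\<^sub>k ?x (Suc (m - i))))"
    by (simp add: growth_seq_Suc GL_comult_natural_growth Suc lin_sum[OF lin_tensor_growth]
        lin_scale[OF lin_tensor_growth] tensor_growth_tens)
  also have "\<dots> = (\<Sum>i\<le>m. scale (of_nat (m choose i)) (?T (Suc i))) +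
      (\<Sum>i\<le>m. scale (of_nat (m choose i)) (?T i))"
    by (simp add: fvs.scale_right_distrib sum.distrib Suc_diff_le)
  \<comment> \<open>The added term has the coefficient \<open>m choose Suc m\<close>, which is
    zero.\<close>
  also have "(\<Sum>i\<le>m. scale (of_nat (m choose i)) (?T i)) = (\<Sum>i\<le>Suc m. scale (of_nat (m choose i)) (?T i))"
    by (simp add: binomial_eq_0)
  also have "\<dots> = ?T 0 + (\<Sum>i\<le>m. scale (of_nat (m choose Suc i)) (?T (Suc i)))"
    by (subst sum.atMost_Suc_shift) simp
  also have "(\<Sum>i\<le>m. scale (of_nat (m choose i)) (?T (Suc i))) + \<dots> =
      ?T 0 + (\<Sum>i\<le>m. scale (of_nat (Suc m choose Suc i)) (?T (Suc i)))"
    by (simp add: fvs.scale_left_distrib sum.distrib add_ac)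
  also have "\<dots> = (\<Sum>i\<le>Suc m. scale (of_nat (Suc m choose i)) (?T i))"
    by (subst sum.atMost_Suc_shift) simp
  finally show ?case .
qed

section \<open>Corollas and linear independence\<close>

definition corolla :: "nat \<Rightarrow> rtree" where
  "corolla n = Node (replicate_mset n e_tree)"

lemma lookup_sum_mset_basis_vec:
  "Poly_Mapping.lookup (\<Sum>w\<in>#M. basis_vec w) z = of_nat (count M z)"
  by (induction M) (auto simp: lookup_add lookup_single when_def)

lemma e_tree_notin_growths: "e_tree \<notin># growths s t"
  by (cases t) (auto simp: e_tree_def growths_Node deriv_mset_def)

text \<open>A child that has grown has at least two vertices and so cannot be a leaf of a
  corolla.\<close>

lemma replicate_notin_deriv_growths: "replicate_mset n e_tree \<notin># deriv_mset (growths s) F"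
proof
  assume "replicate_mset n e_tree \<in># deriv_mset (growths s) F"
  then obtain u w where "w \<in># growths s u" "replicate_mset n e_tree = add_mset w (F - {#u#})"
    by (auto simp: deriv_mset_def)
  then have "w = e_tree"
    by (metis in_replicate_mset union_single_eq_member)
  then show False
    using \<open>w \<in># growths s u\<close> e_tree_notin_growths by blast
qed

text \<open>Only growth at the root can produce a corolla, and each tree grows at its root
  once.\<close>

lemma count_growths_corolla:
  "count (growths e_tree t) (corolla 0) = 0"
  "count (growths e_tree t) (corolla (Suc n)) = (if t = corolla n then 1 else 0)"
proof -
  obtain F where t: "t = Node F" by (cases t)
  have "corolla k \<notin># image_mset Node (deriv_mset (growths e_tree) F)" for k
    using replicate_notin_deriv_growths by (auto simp: corolla_def)
  then have "count (image_mset Node (deriv_mset (growths e_tree) F)) (corolla k) = 0" for k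
    unfolding not_in_iff .
  then have *: "count (growths e_tree (Node F)) (corolla k) = (if Node (add_mset e_tree F) = corolla k then 1 else 0)" for k
    by (simp add: growths_Node)
  then show "count (growths e_tree t) (corolla 0) = 0"
      "count (growths e_tree t) (corolla (Suc n)) = (if t = corolla n then 1 else 0)"
    unfolding t * by (auto simp: corolla_def)
qed

lemma lookup_natural_growth:
  fixes a :: "'k::field GL"
  shows "Poly_Mapping.lookup (natural_growth a) z =
     (\<Sum>t\<in>Poly_Mapping.keys a. Poly_Mapping.lookup a t * of_nat (count (growths e_tree t) z))"
proof -
  have "tree_growth t = (\<Sum>w\<in>#growths e_tree t. basis_vec w :: 'k GL)" for t
    using natural_growth_basis_vec[of t] by (simp add: natural_growth_def)
  then show ?thesis
    unfolding natural_growth_def lin_ext_def by (simp add: lookup_sum lookup_sum_mset_basis_vec)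
qed

lemma lookup_growth_seq_corolla:
  "Poly_Mapping.lookup (growth_seq j) (corolla n) = (if j = n then 1 else 0)"
proof (induction j arbitrary: n)
  case 0
  show ?case
    by (auto simp: growth_seq_0 GL_unit_eq corolla_def lookup_single when_def)
next
  case (Suc j)
  show ?case
  proof (cases n)
    case 0
    then show ?thesis by (simp add: growth_seq_Suc lookup_natural_growth count_growths_corolla)
  next
    case (Suc n')
    have "Poly_Mapping.lookup (growth_seq (Suc j) :: 'a GL) (corolla n) =
        (\<Sum>t\<in>Poly_Mapping.keys (growth_seq j :: 'a GL). if t = corolla n' then Poly_Mapping.lookup (growth_seq j) t else (0 :: 'a))"
      by (simp only: growth_seq_Suc Suc lookup_natural_growth count_growths_corolla)
        (intro sum.cong refl, simp)
    also have "\<dots> = Poly_Mapping.lookup (growth_seq j) (corolla n')"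
      by (simp add: in_keys_iff)
    finally show ?thesis
      using Suc.IH \<open>n = Suc n'\<close> by simp
  qed
qed

lemma inj_growth_seq: "inj growth_seq"
  by (rule injI) (metis lookup_growth_seq_corolla one_neq_zero)

lemma independent_growth_seq: "fvs.independent (range growth_seq)"
  unfolding fvs.independent_explicit_finite_subsets
proof (intro allI impI ballI)
  fix B u v
  assume B: "B \<subseteq> range growth_seq" "finite B" "(\<Sum>v\<in>B. scale (u v) v) = 0" and v: "v \<in> B"
  obtain n where n: "v = growth_seq n" using B(1) v by blast
  \<comment> \<open>The coefficient of \<open>corolla n\<close> is a linear functional that singles
    out \<open>v\<close> among the members of \<open>B\<close>.\<close>
  have "Poly_Mapping.lookup w (corolla n) = (if w = v then 1 else 0)" if "w \<in> B" for w
    using B(1) that by (auto simp: n lookup_growth_seq_corolla dest: injD[OF inj_growth_seq])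
  then have "(\<Sum>w\<in>B. u w * Poly_Mapping.lookup w (corolla n)) = (\<Sum>w\<in>B. if w = v then u w else 0)"
    by (intro sum.cong) auto
  also have "\<dots> = u v" using B(2) v by simp
  also have "(\<Sum>w\<in>B. u w * Poly_Mapping.lookup w (corolla n)) =
      Poly_Mapping.lookup (\<Sum>w\<in>B. scale (u w) w) (corolla n)"
    by (simp add: lookup_sum)
  finally show "u v = 0" using B(3) by simp
qed

lemma GL_counit_growth_seq: "GL_counit (growth_seq m) = (if m = 0 then 1 else 0)"
  using lookup_growth_seq_corolla[of m 0] by (simp add: GL_counit_def corolla_def e_tree_def)

text \<open>In the left antipode axiom at \<open>growth_seq m\<close>, the induction hypothesis
  turns all terms with \<open>i < m\<close> into multiples of \<open>growth_seq m\<close>; the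
  remaining term is the antipode sought.\<close>

lemma GL_antipode_growth_seq: "GL_antipode (growth_seq m) = scale ((- 1) ^ m) (growth_seq m)"
proof (induction m rule: less_induct)
  case (less m)
  let ?x = "growth_seq :: nat \<Rightarrow> 'a GL"
  have eq: "(\<Sum>i\<le>m. scale (of_nat (m choose i)) (GL_antipode (?x i) \<star> ?x (m - i))) =
      scale (GL_counit (?x m)) GL_unit"
    using GL_antipode_left[of "?x m"]
    by (simp add: GL_comult_growth_seq lin_sum[OF lin_tensor_map] lin_scale[OF lin_tensor_map]
        tensor_map_tens[OF lin_GL_antipode lin_id] lin_sum[OF lin_GL_mult_lin]
        lin_scale[OF lin_GL_mult_lin] GL_mult_lin_tens)
  show ?case
  proof (cases "m = 0")
    case True
    with eq show ?thesis
      by (simp add: growth_seq_0 GL_counit_growth_seq[of 0, unfolded growth_seq_0] GL_mult_unit_right)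
  next
    case False
    have "{..m} = insert m {..<m}" by auto
    then have "(\<Sum>i\<le>m. scale (of_nat (m choose i)) (GL_antipode (?x i) \<star> ?x (m - i))) =
       GL_antipode (?x m) + (\<Sum>i<m. scale (of_nat (m choose i)) (GL_antipode (?x i) \<star> ?x (m - i)))"
      by (simp add: growth_seq_0 GL_mult_unit_right)
    also have "(\<Sum>i<m. scale (of_nat (m choose i)) (GL_antipode (?x i) \<star> ?x (m - i))) =
        (\<Sum>i<m. scale ((- 1) ^ i * of_nat (m choose i)) (?x m))"
      by (intro sum.cong refl) (simp add: less GL_mult_linear growth_seq_mult mult_ac)
    also have "\<dots> = scale (\<Sum>i<m. (- 1) ^ i * of_nat (m choose i)) (?x m)"
      by (simp add: fvs.scale_sum_left)
    \<comment> \<open>For \<open>m > 0\<close> the full alternating sum vanishes, so the part below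
      \<open>m\<close> is minus the last term.\<close>
    also have "(\<Sum>i<m. (- 1) ^ i * of_nat (m choose i)) = - ((- 1) ^ m :: 'a)"
      using choose_alternating_sum[of m, where 'a = 'a] False \<open>{..m} = insert m {..<m}\<close>
      by (simp add: add_eq_0_iff)
    finally show ?thesis
      using eq False by (simp add: GL_counit_growth_seq fvs.scale_minus_left)
  qed
qed

section \<open>Comparison with polynomials\<close>

text \<open>This is \<open>p(N)\<close> applied to \<open>e\<close>, where \<open>N\<close> is
  natural growth; it sends \<open>X\<close> to the tree with two vertices.\<close>

definition poly_growth :: "'k::field poly \<Rightarrow> 'k GL" where
  "poly_growth p = (\<Sum>i\<le>degree p. scale (coeff p i) (growth_seq i))"

lemma poly_growth_eq:
  "degree p \<le> n \<Longrightarrow> poly_growth p = (\<Sum>i\<le>n. scale (coeff p i) (growth_seq i))"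
  unfolding poly_growth_def by (rule sum.mono_neutral_left) (auto simp: coeff_eq_0)

lemma poly_growth_add: "poly_growth (p + q) = poly_growth p + poly_growth q"
proof -
  let ?n = "max (degree p) (degree q)"
  show ?thesis
    using degree_add_le_max[of p q]
    by (simp add: poly_growth_eq[of _ ?n] fvs.scale_left_distrib sum.distrib)
qed

lemma poly_growth_smult: "poly_growth (smult c p) = scale c (poly_growth p)"
  by (simp add: poly_growth_eq[of _ "degree p"] degree_smult_le fvs.scale_sum_right)

lemma poly_growth_sum: "poly_growth (\<Sum>x\<in>M. f x) = (\<Sum>x\<in>M. poly_growth (f x))"
proof (induction M rule: infinite_finite_induct)
qed (simp_all add: poly_growth_add, simp_all add: poly_growth_def)

lemma poly_growth_monom: "poly_growth (monom c n) = scale c (growth_seq n)"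
proof -
  have "poly_growth (monom c n) = (\<Sum>i\<le>n. if i = n then scale c (growth_seq i) else 0)"
    unfolding poly_growth_eq[OF degree_monom_le] by (intro sum.cong) auto
  then show ?thesis by simp
qed

lemma linear_poly_growth: "Vector_Spaces.linear smult scale poly_growth"
  unfolding Vector_Spaces.linear_def module_hom_def module_hom_axioms_def
  by (auto simp: poly_growth_add poly_growth_smult vector_space_def module_def smult_add_right
      smult_add_left fvs.scale_right_distrib fvs.scale_left_distrib intro: fvs.vector_space_axioms fvs.module_axioms)

lemma poly_growth_1: "poly_growth 1 = GL_unit"
  by (simp add: poly_growth_def growth_seq_0)

lemma poly_growth_mult: "poly_growth (p * q) = poly_growth p \<star> poly_growth q"
proof -
  have "p * q = (\<Sum>i\<le>degree p. monom (coeff p i) i) * (\<Sum>j\<le>degree q. monom (coeff q j) j)"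
    by (simp add: poly_as_sum_of_monoms)
  also have "\<dots> = (\<Sum>i\<le>degree p. \<Sum>j\<le>degree q. monom (coeff p i * coeff q j) (i + j))"
    by (simp add: sum_product mult_monom)
  finally have "poly_growth (p * q) =
      (\<Sum>i\<le>degree p. \<Sum>j\<le>degree q. scale (coeff p i * coeff q j) (growth_seq (i + j)))"
    by (simp add: poly_growth_sum poly_growth_monom)
  also have "\<dots> = poly_growth p \<star> poly_growth q"
    by (subst sum.swap)
      (simp add: poly_growth_def GL_mult_linear growth_seq_mult fvs.scale_sum_right mult.commute)
  finally show ?thesis .
qed

text \<open>The corolla coefficients recover the polynomial, which gives injectivity.\<close>

lemma lookup_poly_growth: "Poly_Mapping.lookup (poly_growth p) (corolla n) = coeff p n"
proof -
  have "Poly_Mapping.lookup (poly_growth p) (corolla n) = (\<Sum>i\<le>degree p. if i = n then coeff p i else 0)"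
    unfolding poly_growth_def lookup_sum
    by (intro sum.cong) (auto simp: lookup_growth_seq_corolla)
  then show ?thesis by (simp add: coeff_eq_0)
qed

lemma inj_poly_growth: "inj poly_growth"
  by (rule injI) (metis lookup_poly_growth poly_eqI)

lemma range_poly_growth: "range poly_growth = fvs.span (range growth_seq)"
proof
  show "range poly_growth \<subseteq> fvs.span (range growth_seq)"
    by (auto simp: poly_growth_def intro!: fvs.span_sum fvs.span_scale intro: fvs.span_base)
  have "growth_seq n \<in> range poly_growth" for n
    using poly_growth_monom[of 1 n] by (metis fvs.scale_one rangeI)
  moreover have "fvs.subspace (range poly_growth)"
  proof (rule fvs.subspaceI)
    show "0 \<in> range poly_growth"
      by (rule image_eqI[of _ _ 0]) (simp_all add: poly_growth_def)
  qed (auto simp: poly_growth_add[symmetric] poly_growth_smult[symmetric])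
  ultimately show "fvs.span (range growth_seq) \<subseteq> range poly_growth"
    by (intro fvs.span_minimal) auto
qed

lemma GL_comult_poly_growth:
  "GL_comult (poly_growth p) = (\<Sum>m\<le>degree p. scale (coeff p m)
     (\<Sum>i\<le>m. scale (of_nat (m choose i)) (growth_seq i \<otimes>\<^sub>k growth_seq (m - i))))"
  by (simp add: poly_growth_def lin_sum[OF lin_GL_comult] lin_scale[OF lin_GL_comult] GL_comult_growth_seq)

text \<open>Symmetry of the binomial coefficients. It yields cocommutativity, and it adjusts the
  polynomial coproduct, whose coefficients come out indexed by the second tensor factor.\<close>

lemma sum_choose_rev:
  "(\<Sum>i\<le>m. scale (of_nat (m choose i)) (h (m - i) i)) = (\<Sum>i\<le>m. scale (of_nat (m choose i)) (h i (m - i)))"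
  by (rule sum.reindex_bij_witness[of _ "\<lambda>i. m - i" "\<lambda>i. m - i"]) (auto simp: binomial_symmetric[symmetric])

lemma tensor_flip_GL_comult_poly_growth:
  "tensor_flip (GL_comult (poly_growth (p :: 'k::field poly))) = GL_comult (poly_growth p)"
  using sum_choose_rev[where h = "\<lambda>i j. (growth_seq i :: 'k GL) \<otimes>\<^sub>k growth_seq j"]
  by (simp add: GL_comult_poly_growth lin_sum[OF lin_tensor_flip] lin_scale[OF lin_tensor_flip]
      tensor_flip_tens)

section \<open>The coproduct of polynomials\<close>

lemma poly_comult_eq: "poly_comult p = (\<Sum>m\<le>degree p. smult [:coeff p m:] ([:[:0, 1:], 1:] ^ m))"
proof -
  \<comment> \<open>The polynomial \<open>[:[:0, 1:], 1:]\<close> is X + Y: the inner variable X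
    stands for the first tensor factor, the outer variable Y for the second.\<close>
  have X: "poly_tens [:0, 1:] 1 + poly_tens 1 [:0, 1:] = ([:[:0, 1:], 1:] :: 'a poly poly)"
    by (simp add: poly_tens_def map_poly_pCons one_pCons)
  have deg: "degree (map_poly (\<lambda>c. [:[:c:]:]) p) = degree p"
    by (rule degree_map_poly) simp
  show ?thesis
    unfolding poly_comult_def X poly_altdef deg
    by (intro sum.cong) (simp_all add: coeff_map_poly)
qed

text \<open>The binomial theorem for powers of X + Y, with \<open>j\<close> the exponent of the
  outer variable.\<close>

lemma coeff_poly_comult:
  "coeff (coeff (poly_comult p) j) i =
     (\<Sum>m\<le>degree p. coeff p m * (if i + j = m then of_nat (m choose j) else 0))"
proof -
  have "coeff (coeff ([:[:0, 1:], 1:] ^ m) j) i = (if i + j = m then of_nat (m choose j) else (0 :: 'a))" for m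
  proof (cases "j \<le> m")
    case True
    have "coeff ([:[:0, 1 :: 'a:], 1:] ^ m) j = of_nat (m choose j) * monom 1 (m - j)"
      using True by (simp add: coeff_linear_poly_power monom_altdef)
    then show ?thesis
      using True by (auto simp: of_nat_poly)
  next
    case False
    have "degree ([:[:0, 1 :: 'a:], 1:] ^ m) \<le> 1 * m"
      using degree_power_le[of "[:[:0, 1 :: 'a:], 1:]" m] by simp
    then have "coeff ([:[:0, 1 :: 'a:], 1:] ^ m) j = 0"
      using False by (intro coeff_eq_0) simp
    then show ?thesis using False by auto
  qed
  then show ?thesis
    by (simp add: poly_comult_eq coeff_sum)
qed

text \<open>The summation bounds of \<open>poly_tensor_map\<close> vary with the coefficients of
  \<open>P\<close>. A bound \<open>n\<close> on the total degree replaces them by a fixed square,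
  over which sums can be exchanged.\<close>

lemma poly_tensor_map_eq:
  assumes "\<And>i j. n < i + j \<Longrightarrow> coeff (coeff P j) i = 0"
  shows "poly_tensor_map \<phi> P =
    (\<Sum>j\<le>n. \<Sum>i\<le>n. scale (coeff (coeff P j) i) (\<phi> (monom 1 i) \<otimes>\<^sub>k \<phi> (monom 1 j)))"
proof -
  have *: "(\<Sum>i\<le>degree (coeff P j). scale (coeff (coeff P j) i) (\<phi> (monom 1 i) \<otimes>\<^sub>k \<phi> (monom 1 j))) =
    (\<Sum>i\<le>n. scale (coeff (coeff P j) i) (\<phi> (monom 1 i) \<otimes>\<^sub>k \<phi> (monom 1 j)))" for j
  proof (rule sum.mono_neutral_left)
    show "{..degree (coeff P j)} \<subseteq> {..n}"
    proof (cases "coeff P j = 0")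
      case False
      then have "\<not> n < degree (coeff P j) + j"
        using assms[of "degree (coeff P j)" j] by auto
      then show ?thesis by simp
    qed simp
  qed (auto simp: coeff_eq_0)
  have "degree P \<le> n"
    by (rule degree_le) (auto intro!: poly_eqI assms)
  then show ?thesis
    unfolding poly_tensor_map_def * by (intro sum.mono_neutral_left) (auto simp: coeff_eq_0)
qed

lemma GL_comult_poly_growth_tensor:
  fixes p :: "'k::field poly"
  shows "GL_comult (poly_growth p) = poly_tensor_map poly_growth (poly_comult p)"
proof -
  let ?n = "degree p"
  let ?T = "\<lambda>i j. (growth_seq i :: 'k GL) \<otimes>\<^sub>k growth_seq j"
  have "poly_tensor_map poly_growth (poly_comult p) =
      (\<Sum>j\<le>?n. \<Sum>i\<le>?n. scale (coeff (coeff (poly_comult p) j) i) (?T i j))"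
    by (subst poly_tensor_map_eq[of ?n]) (auto simp: coeff_poly_comult poly_growth_monom intro!: sum.neutral)
  also have "\<dots> = (\<Sum>j\<le>?n. \<Sum>i\<le>?n. \<Sum>m\<le>?n.
      scale (coeff p m) (if i + j = m then scale (of_nat (m choose j)) (?T i j) else 0))"
    unfolding coeff_poly_comult fvs.scale_sum_left
    by (intro sum.cong refl) auto
  also have "\<dots> = (\<Sum>m\<le>?n. scale (coeff p m) (\<Sum>j\<le>?n. \<Sum>i\<le>?n.
      if i + j = m then scale (of_nat (m choose j)) (?T i j) else 0))"
    unfolding fvs.scale_sum_right by (rule trans[OF sum.cong[OF refl sum.swap] sum.swap])
  also have "\<dots> = (\<Sum>m\<le>?n. scale (coeff p m) (\<Sum>j\<le>m. scale (of_nat (m choose j)) (?T (m - j) j)))"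
  proof (rule sum.cong[OF refl], rule arg_cong[where f = "scale _"])
    fix m assume m: "m \<in> {..?n}"
    have "(\<Sum>i\<le>?n. if i + j = m then scale (of_nat (m choose j)) (?T i j) else 0) =
        (if j \<le> m then scale (of_nat (m choose j)) (?T (m - j) j) else 0)" for j
    proof -
      \<comment> \<open>Subtraction of naturals is truncated, so \<open>i = m - j\<close> alone
        would also admit \<open>j > m\<close>; hence the inner test.\<close>
      have "(\<Sum>i\<le>?n. if i + j = m then scale (of_nat (m choose j)) (?T i j) else 0) =
         (\<Sum>i\<le>?n. if i = m - j then if j \<le> m then scale (of_nat (m choose j)) (?T i j) else 0 else 0)"
        by (intro sum.cong) auto
      moreover have "m - j \<le> ?n"
        using m by simp
      ultimately show ?thesis by simp
    qed
    then have "(\<Sum>j\<le>?n. \<Sum>i\<le>?n. if i + j = m then scale (of_nat (m choose j)) (?T i j) else 0) =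
        (\<Sum>j\<le>?n. if j \<le> m then scale (of_nat (m choose j)) (?T (m - j) j) else 0)"
      by simp
    also have "\<dots> = (\<Sum>j\<le>m. scale (of_nat (m choose j)) (?T (m - j) j))"
      using m by (intro sum.mono_neutral_cong_right) auto
    finally show "(\<Sum>j\<le>?n. \<Sum>i\<le>?n. if i + j = m then scale (of_nat (m choose j)) (?T i j) else 0) =
      (\<Sum>j\<le>m. scale (of_nat (m choose j)) (?T (m - j) j))" .
  qed
  also have "\<dots> = GL_comult (poly_growth p)"
    by (simp add: GL_comult_poly_growth sum_choose_rev[where h = ?T])
  finally show ?thesis ..
qed

lemma GL_counit_poly_growth: "GL_counit (poly_growth p) = poly_counit p"
  using lookup_poly_growth[of p 0]
  by (simp add: GL_counit_def poly_counit_def poly_0_coeff_0 corolla_def e_tree_def)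

lemma GL_antipode_poly_growth: "GL_antipode (poly_growth p) = poly_growth (poly_antipode p)"
proof -
  have "degree (poly_antipode p) \<le> degree p"
    using degree_pcompose_le[of p "[:0, - 1:]"] by (simp add: poly_antipode_def)
  then show ?thesis
    by (simp add: poly_growth_eq[of _ "degree p"] lin_sum[OF lin_GL_antipode] lin_scale[OF lin_GL_antipode]
        GL_antipode_growth_seq poly_antipode_def coeff_pcompose_linear mult_ac)
qed

lemma poly_GL_hopf_iso_poly_growth: "poly_GL_hopf_iso poly_growth (fvs.span (range growth_seq))"
  unfolding poly_GL_hopf_iso_def bij_betw_def
  by (simp add: linear_poly_growth inj_poly_growth range_poly_growth poly_growth_1 poly_growth_mult
    GL_comult_poly_growth_tensor GL_counit_poly_growth GL_antipode_poly_growth)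

text \<open>Every element of the span is some \<open>poly_growth p\<close>, so closure under product
  and antipode comes from polynomials, and the coproduct is visible in the binomial formula.\<close>

lemma GL_hopf_subalgebra_growth:
  "GL_hopf_subalgebra (fvs.span (range growth_seq) :: 'k::field GL set)"
proof -
  let ?H = "fvs.span (range growth_seq) :: 'k GL set"
  have mem: "poly_growth p \<in> ?H" for p :: "'k poly"
    unfolding range_poly_growth[symmetric] by simp
  have ex: "\<exists>p. a = poly_growth p" if "a \<in> ?H" for a
    using that unfolding range_poly_growth[symmetric] by blast
  have "a \<star> b \<in> ?H" if "a \<in> ?H" "b \<in> ?H" for a b
    using ex[OF that(1)] ex[OF that(2)] mem by (auto simp flip: poly_growth_mult)
  moreover have "GL_antipode a \<in> ?H" if "a \<in> ?H" for a
    using ex[OF that] mem by (auto simp: GL_antipode_poly_growth)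
  moreover have "GL_comult a \<in> fvs.span {b \<otimes>\<^sub>k c | b c. b \<in> ?H \<and> c \<in> ?H}" if a_mem: "a \<in> ?H" for a
  proof -
    obtain p where a: "a = poly_growth p" using ex[OF a_mem] ..
    have "growth_seq i \<otimes>\<^sub>k growth_seq j \<in> {b \<otimes>\<^sub>k c | b c. b \<in> ?H \<and> c \<in> ?H}" for i j
      by (blast intro: fvs.span_base)
    then show ?thesis
      unfolding a GL_comult_poly_growth by (intro fvs.span_sum fvs.span_scale fvs.span_base)
  qed
  moreover have "GL_unit \<in> ?H"
    using mem[of 1] by (simp add: poly_growth_1)
  ultimately show ?thesis
    unfolding GL_hopf_subalgebra_def by (simp add: fvs.subspace_span)
qed

theorem proposition2p3:
  fixes x :: "nat \<Rightarrow> 'k::field_char_0 GL" and H :: "'k GL set"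
  assumes x_def: "\<And>j. x j = (natural_growth ^^ j) GL_unit"
    and H_def: "H = fvs.span (range x)"
  shows
    "(\<forall>m n. x m \<star> x n = x (m + n) \<and> x n \<star> x m = x (m + n)) \<and>
     x 0 = GL_unit \<and>
     (\<forall>m. GL_counit (x m) = (if m = 0 then 1 else 0)) \<and>
     (\<forall>m. GL_comult (x m) = (\<Sum>i=0..m. scale (of_nat (m choose i)) (x i \<otimes>\<^sub>k x (m - i)))) \<and>
     (\<forall>m. GL_antipode (x m) = scale ((- 1) ^ m) (x m)) \<and>
     inj x \<and> fvs.independent (range x) \<and>
     GL_hopf_subalgebra H \<and> GL_commutative_on H \<and> GL_cocommutative_on H \<and>
     (\<exists>\<phi>. poly_GL_hopf_iso \<phi> H)"
proof -
  have x: "x = growth_seq"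
    by (simp add: fun_eq_iff x_def growth_seq_def)
  have H: "H = range poly_growth"
    by (simp add: H_def x range_poly_growth)
  \<comment> \<open>Commutativity is that of polynomial multiplication, carried over by
    \<open>poly_growth\<close>.\<close>
  have "GL_commutative_on H"
    unfolding GL_commutative_on_def H
    by (auto simp: mult.commute simp flip: poly_growth_mult)
  moreover have "GL_cocommutative_on H"
    unfolding GL_cocommutative_on_def H by (auto simp: tensor_flip_GL_comult_poly_growth)
  moreover have "GL_hopf_subalgebra H" "poly_GL_hopf_iso poly_growth H"
    unfolding H_def x by (rule GL_hopf_subalgebra_growth poly_GL_hopf_iso_poly_growth)+
  ultimately show ?thesis
    unfolding x using growth_seq_0 inj_growth_seq independent_growth_seq
    by (auto simp: growth_seq_mult add.commute GL_counit_growth_seq GL_comult_growth_seq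
        GL_antipode_growth_seq atLeast0AtMost)
qed

end
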